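(* Let $V$ be a finite-dimensional Euclidean vector space, $I\subset\mathbb{R}$ an interval, and $R(t)$, $t\in I$, a smooth family of symmetric endomorphisms of $V$. Let $\mathrm{Jac}$ be the symplectic vector space of solutions of the Jacobi equation $Y''(t)+R(t)Y(t)=0$ on $I$. Let $\Lambda_1,\Lambda_2\subset \mathrm{Jac}$ be any Lagrangian subspaces. Then for any interval $I_0\subset I$ we have $$\mathrm{ind}_{\Lambda_1}(I_0)-\mathrm{ind}_{\Lambda_2}(I_0)\le \dim(V),$$ where, if the indices are infinite, the inequality is read as $\mathrm{ind}_{\Lambda_1}(I_0)\le \mathrm{ind}_{\Lambda_2}(I_0)+\dim(V)$ in $\mathbb{N}\cup\{\infty\}$.
   Context: $\mathrm{Jac}$ denotes the vector space of all solutions $J:I\to V$ (Jacobi fields) of $Y''+R(t)Y=0$; it carries the symplectic form $\omega(J_1,J_2)=\langle J_1(t),J_2'(t)\rangle-\langle J_1'(t),J_2(t)\rangle$, which is independent of $t\in I$. For a subspace $W\subset \mathrm{Jac}$, $W^{\perp}$ is the orthogonal complement with respect to $\omega$; $W$ is isotropic if $W\subset W^\perp$ and Lagrangian if $W=W^\perp$. For isotropic $W$ and $t\in I$ set $W(t)=\{J(t)\mid J\in W\}$, $W^t=\{J\in W\mid J(t)=0\}$, and define the $W$-focal index $f^W(t)=\dim(W^t)=\dim(W)-\dim(W(t))$; $t$ is called $W$-focal if $f^W(t)>0$. For a subinterval $I_0\subset I$ the $W$-index is $\mathrm{ind}_W(I_0)=\sum_{t\in I_0} f^W(t)\in\mathbb{N}\cup\{\infty\}$.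 *)

theory Defs
  imports "HOL-Analysis.Analysis" "HOL-Library.Function_Algebras"
begin

text \<open>Pointwise scalar multiplication makes \<open>real \<Rightarrow> V\<close> a real vector space (addition is pointwise by
  \<^theory>\<open>HOL-Library.Function_Algebras\<close>), so that \<^const>\<open>subspace\<close> and \<^const>\<open>dim\<close> apply to sets of
  vector fields.\<close>

instantiation "fun" :: (type, scaleR) scaleR
begin

definition scaleR_fun_def: "c *\<^sub>R f = (\<lambda>x. c *\<^sub>R f x)"

instance ..

end

lemma scaleR_fun_apply [simp]: "(c *\<^sub>R f) x = c *\<^sub>R f x"
  by (simp add: scaleR_fun_def)

instance "fun" :: (type, real_vector) real_vector
  by standard (auto simp: fun_eq_iff scaleR_add_right scaleR_add_left)

text \<open>Infinitely differentiable on \<open>I\<close>, with one-sided derivatives at endpoints belonging to \<open>I\<close>;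
  \<open>D n\<close> is the \<open>n\<close>-th derivative.\<close>

definition smooth_family_on :: "real set \<Rightarrow> (real \<Rightarrow> 'b::real_normed_vector) \<Rightarrow> bool" where
  "smooth_family_on I f \<longleftrightarrow>
     (\<exists>D :: nat \<Rightarrow> real \<Rightarrow> 'b. (\<forall>t\<in>I. D 0 t = f t) \<and>
        (\<forall>n. \<forall>t\<in>I. (D n has_vector_derivative D (Suc n) t) (at t within I)))"

definition symmetric_endo :: "('a::real_inner \<Rightarrow>\<^sub>L 'a) \<Rightarrow> bool" where
  "symmetric_endo A \<longleftrightarrow> (\<forall>x y. blinfun_apply A x \<bullet> y = x \<bullet> blinfun_apply A y)"

text \<open>A field \<open>J : I \<rightarrow> V\<close> is represented by the function that extends it by \<open>0\<close> outside \<open>I\<close>. Every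
  function on \<open>I\<close> then has exactly one representative and the representatives form a vector space,
  so dimensions are those of spaces of functions on \<open>I\<close>.\<close>

definition Jac :: "real set \<Rightarrow> (real \<Rightarrow> 'a::euclidean_space \<Rightarrow>\<^sub>L 'a) \<Rightarrow> (real \<Rightarrow> 'a) set" where
  "Jac I R = {J. (\<forall>t. t \<notin> I \<longrightarrow> J t = 0) \<and>
     (\<exists>J'. \<forall>t\<in>I. (J has_vector_derivative J' t) (at t within I) \<and>
                 (J' has_vector_derivative - blinfun_apply (R t) (J t)) (at t within I))}"

definition wronskian_at :: "real set \<Rightarrow> real \<Rightarrow> (real \<Rightarrow> 'a::euclidean_space) \<Rightarrow> (real \<Rightarrow> 'a) \<Rightarrow> real" where
  "wronskian_at I t J1 J2 =
     J1 t \<bullet> vector_derivative J2 (at t within I) - vector_derivative J1 (at t within I) \<bullet> J2 t"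

text \<open>The evaluation point is irrelevant for Jacobi fields, see \<open>omega_eq_wronskian_at\<close> below.\<close>

definition omega :: "real set \<Rightarrow> (real \<Rightarrow> 'a::euclidean_space) \<Rightarrow> (real \<Rightarrow> 'a) \<Rightarrow> real" where
  "omega I J1 J2 = wronskian_at I (SOME t. t \<in> I) J1 J2"

definition omega_complement ::
  "real set \<Rightarrow> (real \<Rightarrow> 'a::euclidean_space \<Rightarrow>\<^sub>L 'a) \<Rightarrow> (real \<Rightarrow> 'a) set \<Rightarrow> (real \<Rightarrow> 'a) set" where
  "omega_complement I R W = {J \<in> Jac I R. \<forall>K\<in>W. omega I J K = 0}"

definition lagrangian ::
  "real set \<Rightarrow> (real \<Rightarrow> 'a::euclidean_space \<Rightarrow>\<^sub>L 'a) \<Rightarrow> (real \<Rightarrow> 'a) set \<Rightarrow> bool" where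
  "lagrangian I R W \<longleftrightarrow> subspace W \<and> W \<subseteq> Jac I R \<and> W = omega_complement I R W"

text \<open>A Jacobi field is determined by \<open>(J t, J' t)\<close> at one point of \<open>I\<close>, so subspaces of \<^const>\<open>Jac\<close> are
  finite-dimensional and \<^const>\<open>dim\<close> is their genuine dimension.\<close>

definition focal_index :: "(real \<Rightarrow> 'a::euclidean_space) set \<Rightarrow> real \<Rightarrow> nat" where
  "focal_index W t = dim {J \<in> W. J t = 0}"

text \<open>A sum of extended naturals always converges: its value is the supremum of the finite partial
  sums, and it is \<open>\<infinity>\<close> if infinitely many points contribute.\<close>

definition ind :: "(real \<Rightarrow> 'a::euclidean_space) set \<Rightarrow> real set \<Rightarrow> enat" where
  "ind W I0 = (\<Sum>\<^sub>\<infinity>t\<in>I0. enat (focal_index W t))"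

lemma nondegenerate_interval_at_within:
  fixes I :: "real set"
  assumes "is_interval I" "interior I \<noteq> {}" "t \<in> I"
  shows "at t within I \<noteq> bot"
proof -
  have "connected I" using assms(1) by (simp add: is_interval_connected)
  moreover have "\<not> (\<exists>a. I = {a})" using assms(2) by auto
  ultimately have "t islimpt I"
    using assms(3) connected_imp_perfect by blast
  then show ?thesis by (simp add: trivial_limit_within)
qed

lemma subspace_Jac: "subspace (Jac I R)"
proof (rule subspaceI)
  show "0 \<in> Jac I R"
    by (auto simp: Jac_def zero_fun_def intro!: exI[of _ "\<lambda>_. 0"])
next
  fix J K assume "J \<in> Jac I R" "K \<in> Jac I R"
  then obtain J' K' where *: "\<forall>t. t \<notin> I \<longrightarrow> J t = 0" "\<forall>t. t \<notin> I \<longrightarrow> K t = 0"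
    "\<forall>t\<in>I. (J has_vector_derivative J' t) (at t within I) \<and>
       (J' has_vector_derivative - blinfun_apply (R t) (J t)) (at t within I)"
    "\<forall>t\<in>I. (K has_vector_derivative K' t) (at t within I) \<and>
       (K' has_vector_derivative - blinfun_apply (R t) (K t)) (at t within I)"
    unfolding Jac_def by auto
  then show "J + K \<in> Jac I R"
    unfolding Jac_def plus_fun_def
    by (auto intro!: exI[of _ "\<lambda>t. J' t + K' t"] derivative_eq_intros simp: blinfun.add_right)
next
  fix c J assume "J \<in> Jac I R"
  then obtain J' where *: "\<forall>t. t \<notin> I \<longrightarrow> J t = 0"
    "\<forall>t\<in>I. (J has_vector_derivative J' t) (at t within I) \<and>
       (J' has_vector_derivative - blinfun_apply (R t) (J t)) (at t within I)"
    unfolding Jac_def by auto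
  have "\<forall>t\<in>I. ((\<lambda>x. c *\<^sub>R J x) has_vector_derivative c *\<^sub>R J' t) (at t within I) \<and>
       ((\<lambda>x. c *\<^sub>R J' x) has_vector_derivative - blinfun_apply (R t) (c *\<^sub>R J t)) (at t within I)"
  proof
    fix t assume "t \<in> I"
    then have "(J has_vector_derivative J' t) (at t within I)"
      "(J' has_vector_derivative - blinfun_apply (R t) (J t)) (at t within I)" using * by auto
    from this[THEN bounded_linear.has_vector_derivative[OF bounded_linear_scaleR_right[of c]]]
    show "((\<lambda>x. c *\<^sub>R J x) has_vector_derivative c *\<^sub>R J' t) (at t within I) \<and>
       ((\<lambda>x. c *\<^sub>R J' x) has_vector_derivative - blinfun_apply (R t) (c *\<^sub>R J t)) (at t within I)"
      by (simp add: blinfun.scaleR_right)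
  qed
  then show "c *\<^sub>R J \<in> Jac I R"
    unfolding Jac_def scaleR_fun_def using *(1) by auto
qed

lemma wronskian_at_constant:
  assumes I: "is_interval I" "interior I \<noteq> {}"
    and sym: "\<And>t. t \<in> I \<Longrightarrow> symmetric_endo (R t)"
    and J: "J \<in> Jac I R" and K: "K \<in> Jac I R" and st: "s \<in> I" "t \<in> I"
  shows "wronskian_at I s J K = wronskian_at I t J K"
proof -
  obtain J' K' where
    J': "\<And>t. t\<in>I \<Longrightarrow> (J has_vector_derivative J' t) (at t within I)"
        "\<And>t. t\<in>I \<Longrightarrow> (J' has_vector_derivative - blinfun_apply (R t) (J t)) (at t within I)" and
    K': "\<And>t. t\<in>I \<Longrightarrow> (K has_vector_derivative K' t) (at t within I)"
        "\<And>t. t\<in>I \<Longrightarrow> (K' has_vector_derivative - blinfun_apply (R t) (K t)) (at t within I)"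
    using J K unfolding Jac_def mem_Collect_eq by metis
  have w: "wronskian_at I u J K = J u \<bullet> K' u - J' u \<bullet> K u" if "u \<in> I" for u
    unfolding wronskian_at_def
    using nondegenerate_interval_at_within[OF I that] J'(1)[OF that] K'(1)[OF that]
    by (simp add: vector_derivative_within)
  have "((\<lambda>u. J u \<bullet> K' u - J' u \<bullet> K u) has_derivative (\<lambda>h. 0)) (at u within I)" if "u \<in> I" for u
  proof -
    have s: "blinfun_apply (R u) (J u) \<bullet> K u = J u \<bullet> blinfun_apply (R u) (K u)"
      using sym[OF that] by (simp add: symmetric_endo_def)
    show ?thesis
      using J'[OF that] K'[OF that] unfolding has_vector_derivative_def
      by (auto intro!: derivative_eq_intros simp: s fun_eq_iff algebra_simps)
  qed
  then have "\<exists>c. \<forall>u\<in>I. J u \<bullet> K' u - J' u \<bullet> K u = c"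
    using has_derivative_zero_constant[of I "\<lambda>u. J u \<bullet> K' u - J' u \<bullet> K u"] I(1)
    by (auto simp: is_interval_convex)
  then show ?thesis using st w by auto
qed

lemma omega_eq_wronskian_at:
  assumes "is_interval I" "interior I \<noteq> {}"
    and "\<And>t. t \<in> I \<Longrightarrow> symmetric_endo (R t)"
    and "J \<in> Jac I R" "K \<in> Jac I R" and "t \<in> I"
  shows "omega I J K = wronskian_at I t J K"
  unfolding omega_def
  using wronskian_at_constant[OF assms(1-5) _ assms(6)] assms(6) by (metis someI)

end

theory Submission
  imports Defs
begin

text \<open>
  Let \<open>T\<close> be a finite set of times containing all \<open>\<Lambda>2\<close>-focal ones between its extremes. Suppose the
  \<open>\<Lambda>1\<close>-index over \<open>T\<close> exceeds the \<open>\<Lambda>2\<close>-index by more than \<open>dim V\<close>. For \<open>t \<in> T\<close> take \<open>F t \<in> \<Lambda>1\<close> vanishing at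
  \<open>t\<close>, from a complement of \<open>\<Lambda>1 \<inter> \<Lambda>2\<close>, and consider the continuous broken field equal to
  \<open>Y s = (\<Sum>t > s. F t)\<close> just after \<open>s \<in> T\<close>. Counting dimensions, the \<open>F t\<close> can be chosen not all zero so that the
  broken field vanishes at \<open>Min T\<close> (and automatically at \<open>Max T\<close>) and lies in \<open>\<Lambda>2(t)\<close> at every \<open>t \<in> T\<close>. No
  conditions need to be spent on fields of \<open>\<Lambda>1 \<inter> \<Lambda>2\<close>, because their velocities at their zeros are
  orthogonal to \<open>\<Lambda>1(t)\<close>.

  For \<open>K u \<in> \<Lambda>2\<close> agreeing with the broken field \<open>Y\<close> at \<open>u\<close>, the number \<open>\<omega>(K u, Y)\<close> varies continuously with \<open>u\<close>,
  even through \<open>\<Lambda>2\<close>-focal times and break points, and its derivative is a square, which vanishes only where \<open>Y\<close> is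
  tangent to \<open>\<Lambda>2\<close>. It is \<open>0\<close> at both ends, so all \<open>F t\<close> lie in \<open>\<Lambda>2\<close>, contradicting the choice of complements.
  This replaces the index form of Morse theory by its integrated Riccati identity.
\<close>

section \<open>Linear ordinary differential equations\<close>

text \<open>Gronwall's estimate in both time directions. Since |u'| \<le> 2 M u for the squared norm
  \<open>u\<close>, the weight exp(2 M t) makes it nondecreasing and exp(-2 M t) nonincreasing; the
  first bounds \<open>u\<close> backwards in time, the second forwards.\<close>

lemma linear_ode_growth:
  fixes Y :: "real \<Rightarrow> 'b::real_inner"
  assumes Y: "\<And>t. t \<in> {a..b} \<Longrightarrow> (Y has_vector_derivative blinfun_apply (A t) (Y t)) (at t within {a..b})"
    and M: "\<And>t. t \<in> {a..b} \<Longrightarrow> norm (A t) \<le> M"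
    and st: "s \<in> {a..b}" "t \<in> {a..b}"
  shows "norm (Y t) \<le> exp (M * \<bar>t - s\<bar>) * norm (Y s)"
proof -
  define u where "u t = Y t \<bullet> Y t" for t
  have cont: "continuous_on {a..b} Y"
    using Y by (rule continuous_on_vector_derivative)
  have bound: "\<bar>Y x \<bullet> A x (Y x)\<bar> \<le> M * u x" if "x \<in> {a..b}" for x
  proof -
    have "\<bar>Y x \<bullet> A x (Y x)\<bar> \<le> norm (Y x) * norm (A x (Y x))"
      by (rule Cauchy_Schwarz_ineq2)
    also have "\<dots> \<le> norm (Y x) * (M * norm (Y x))"
      using order_trans[OF norm_blinfun mult_right_mono[OF M[OF that] norm_ge_zero]]
      by (intro mult_left_mono) auto
    finally show ?thesis by (simp add: u_def dot_square_norm power2_eq_square algebra_simps)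
  qed
  have deriv: "((\<lambda>x. exp (2 * c * x) * u x) has_real_derivative
      2 * exp (2 * c * x) * (c * u x + Y x \<bullet> A x (Y x))) (at x)"
    if "a < x" "x < b" for x c
  proof -
    have "(Y has_vector_derivative A x (Y x)) (at x)"
      using Y[of x] at_within_Icc_at[OF that] that by simp
    then have "(u has_derivative (\<lambda>h. h *\<^sub>R (2 * (Y x \<bullet> A x (Y x))))) (at x)"
      unfolding u_def has_vector_derivative_def
      by (auto intro!: derivative_eq_intros simp: inner_commute)
    then have "(u has_real_derivative 2 * (Y x \<bullet> A x (Y x))) (at x)"
      by (simp add: has_real_derivative_iff_has_vector_derivative has_vector_derivative_def)
    then show ?thesis
      by (auto intro!: derivative_eq_intros simp: algebra_simps)
  qed
  have cu: "continuous_on S (\<lambda>x. exp (2 * c * x) * u x)" if "S \<subseteq> {a..b}" for S c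
    unfolding u_def using continuous_on_subset[OF cont that] by (intro continuous_intros)
  have up: "exp (2 * M * x) * u x \<le> exp (2 * M * y) * u y" if "x \<le> y" "x \<in> {a..b}" "y \<in> {a..b}" for x y
  proof (rule DERIV_nonneg_imp_increasing_open[OF that(1)])
    fix z assume z: "x < z" "z < y"
    show "\<exists>d. ((\<lambda>x. exp (2 * M * x) * u x) has_real_derivative d) (at z) \<and> 0 \<le> d"
      using deriv[of z M] bound[of z] z that by (intro exI conjI, assumption?) auto
  qed (use that in \<open>auto intro!: cu\<close>)
  have down: "exp (2 * - M * y) * u y \<le> exp (2 * - M * x) * u x" if "x \<le> y" "x \<in> {a..b}" "y \<in> {a..b}" for x y
  proof (rule DERIV_nonpos_imp_decreasing_open[OF that(1)])
    fix z assume z: "x < z" "z < y"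
    have "- M * u z + Y z \<bullet> A z (Y z) \<le> 0"
      using bound[of z] z that by auto
    then have "2 * exp (2 * - M * z) * (- M * u z + Y z \<bullet> A z (Y z)) \<le> 0"
      by (intro mult_nonneg_nonpos) auto
    then show "\<exists>d. ((\<lambda>x. exp (2 * - M * x) * u x) has_real_derivative d) (at z) \<and> d \<le> 0"
      using deriv[of z "- M"] z that by auto
  next
    show "continuous_on {x..y} (\<lambda>x. exp (2 * - M * x) * u x)"
      using that by (intro cu) auto
  qed
  have "u t \<le> exp (2 * M * \<bar>t - s\<bar>) * u s"
  proof (cases "s \<le> t")
    case True
    have "u t = exp (2 * M * t) * (exp (2 * - M * t) * u t)"
      by (simp add: mult.assoc[symmetric] flip: exp_add)
    also have "\<dots> \<le> exp (2 * M * t) * (exp (2 * - M * s) * u s)"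
      by (rule mult_left_mono[OF down[OF True st] exp_ge_zero])
    also have "\<dots> = exp (2 * M * t + 2 * - M * s) * u s"
      by (simp only: exp_add mult.assoc)
    also have "2 * M * t + 2 * - M * s = 2 * M * \<bar>t - s\<bar>"
      using True by (simp add: algebra_simps)
    finally show ?thesis .
  next
    case False
    have "u t = exp (2 * - M * t) * (exp (2 * M * t) * u t)"
      by (simp add: mult.assoc[symmetric] flip: exp_add)
    also have "\<dots> \<le> exp (2 * - M * t) * (exp (2 * M * s) * u s)"
      using False st by (intro mult_left_mono[OF up exp_ge_zero]) linarith+
    also have "\<dots> = exp (2 * - M * t + 2 * M * s) * u s"
      by (simp only: exp_add mult.assoc)
    also have "2 * - M * t + 2 * M * s = 2 * M * \<bar>t - s\<bar>"
      using False by (simp add: algebra_simps)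
    finally show ?thesis .
  qed
  also have "\<dots> = (exp (M * \<bar>t - s\<bar>) * norm (Y s))\<^sup>2"
    by (simp add: u_def power_mult_distrib dot_square_norm exp_double[symmetric] mult.assoc)
  finally have "(norm (Y t))\<^sup>2 \<le> (exp (M * \<bar>t - s\<bar>) * norm (Y s))\<^sup>2"
    by (simp add: u_def dot_square_norm)
  then show ?thesis by (rule power2_le_imp_le) simp
qed

text \<open>The difference of two solutions solves the same equation, and the growth estimate
  propagates its zero at \<open>s\<close>; compactness supplies the bound on
  \<open>A\<close>.\<close>

lemma linear_ode_unique:
  fixes X Y :: "real \<Rightarrow> 'b::real_inner"
  assumes A: "continuous_on {a..b} A"
    and X: "\<And>t. t \<in> {a..b} \<Longrightarrow> (X has_vector_derivative blinfun_apply (A t) (X t)) (at t within {a..b})"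
    and Y: "\<And>t. t \<in> {a..b} \<Longrightarrow> (Y has_vector_derivative blinfun_apply (A t) (Y t)) (at t within {a..b})"
    and st: "s \<in> {a..b}" "X s = Y s" "t \<in> {a..b}"
  shows "X t = Y t"
proof -
  have "bounded (A ` {a..b})"
    by (intro compact_imp_bounded compact_continuous_image A) simp
  then obtain M where "\<forall>x\<in>A ` {a..b}. norm x \<le> M"
    unfolding bounded_iff by blast
  then have M: "\<And>t. t \<in> {a..b} \<Longrightarrow> norm (A t) \<le> M" by blast
  have "norm (X t - Y t) \<le> exp (M * \<bar>t - s\<bar>) * norm (X s - Y s)"
    by (rule linear_ode_growth[where A = A and a = a and b = b])
       (use M st in \<open>auto intro!: has_vector_derivative_diff X Y simp: blinfun.diff_right\<close>)
  then show ?thesis using st by simp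
qed

text \<open>The Picard iterates are summed with the weight \<open>exp (2 * M * (t - a))\<close>, in which the \<open>k\<close>-th one is \<open>O(1 / 2 ^ k)\<close>.\<close>

lemma linear_ode_exists_left:
  fixes A :: "real \<Rightarrow> 'b::euclidean_space \<Rightarrow>\<^sub>L 'b"
  assumes A: "continuous_on {a..b} A" and ab: "a \<le> b"
  shows "\<exists>Y. Y a = e \<and> (\<forall>t\<in>{a..b}. (Y has_vector_derivative A t (Y t)) (at t within {a..b}))"
proof -
  have "bounded (A ` {a..b})"
    by (intro compact_imp_bounded compact_continuous_image A) simp
  then obtain M where "\<forall>x\<in>A ` {a..b}. norm x \<le> M" and M0: "M > 0"
    unfolding bounded_pos by blast
  then have M: "\<And>t. t \<in> {a..b} \<Longrightarrow> norm (A t) \<le> M" by blast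
  \<comment> \<open>These are the increments of Picard iteration: only \<open>y 0\<close> carries
    the initial value \<open>e\<close>, all later terms vanish at \<open>a\<close>.\<close>
  define y where "y = rec_nat (\<lambda>_. e) (\<lambda>_ f t. integral {a..t} (\<lambda>s. A s (f s)))"
  have y0: "y 0 = (\<lambda>_. e)" and yS: "y (Suc k) = (\<lambda>t. integral {a..t} (\<lambda>s. A s (y k s)))" for k
    by (simp_all add: y_def)
  have cont: "continuous_on {a..b} (y k) \<and> (\<forall>t\<in>{a..b}. (y (Suc k) has_vector_derivative A t (y k t)) (at t within {a..b}))" for k
  proof (induction k)
    case 0
    show ?case unfolding yS y0
      by (auto intro!: integral_has_vector_derivative continuous_intros A)
  next
    case (Suc k)
    then have c: "continuous_on {a..b} (y (Suc k))"
      by (auto intro: continuous_on_vector_derivative)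
    have "(y (Suc (Suc k)) has_vector_derivative A t (y (Suc k) t)) (at t within {a..b})" if "t \<in> {a..b}" for t
      unfolding yS[of "Suc k"]
      by (rule integral_has_vector_derivative[OF _ that]) (intro continuous_intros A c)
    then show ?case using c by blast
  qed
  have bound: "norm (y k t) \<le> norm e * exp (2 * M * (t - a)) * (1/2)^k" if "t \<in> {a..b}" for k t
    using that
  proof (induction k arbitrary: t)
    case 0
    have "1 \<le> exp (2 * M * (t - a))" using 0 M0 by auto
    then show ?case using mult_left_mono[of 1 "exp (2 * M * (t - a))" "norm e"] by (simp add: y0)
  next
    case (Suc k)
    \<comment> \<open>Differentiation brings down a factor 2 M, whose 2 turns
      \<open>(1/2)^Suc k\<close> into \<open>(1/2)^k\<close>: the derivative of this majorant is M
      times the previous majorant.\<close>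
    let ?\<phi> = "\<lambda>t. norm e * exp (2 * M * (t - a)) * (1/2)^Suc k"
    have ya: "y (Suc k) a = 0" by (simp add: yS)
    show ?case
    proof (cases "t = a")
      case True
      then show ?thesis by (simp add: ya)
    next
      case False
      then have at: "a < t" using Suc by auto
      have "norm (y (Suc k) t - y (Suc k) a) \<le> ?\<phi> t - ?\<phi> a"
      proof (rule differentiable_bound_general[OF at])
        show "continuous_on {a..t} (y (Suc k))"
          using cont[of "Suc k"] Suc.prems by (auto intro: continuous_on_subset)
        show "continuous_on {a..t} ?\<phi>" by (intro continuous_intros)
        show "(?\<phi> has_vector_derivative M * (norm e * exp (2 * M * (x - a)) * (1/2)^k)) (at x)" for x
          by (auto intro!: derivative_eq_intros simp: has_real_derivative_iff_has_vector_derivative[symmetric])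
        fix x assume x: "a < x" "x < t"
        then have xab: "x \<in> {a..b}" using Suc.prems by auto
        show "(y (Suc k) has_vector_derivative A x (y k x)) (at x)"
          using cont[of k] xab at_within_Icc_at[of a x b] x Suc.prems by (metis atLeastAtMost_iff order_less_le_trans)
        have "norm (A x (y k x)) \<le> norm (A x) * norm (y k x)" by (rule norm_blinfun)
        also have "\<dots> \<le> M * (norm e * exp (2 * M * (x - a)) * (1/2)^k)"
          using Suc.IH[OF xab] M[OF xab] M0 by (intro mult_mono) auto
        finally show "norm (A x (y k x)) \<le> M * (norm e * exp (2 * M * (x - a)) * (1/2)^k)" .
      qed
      moreover have "0 \<le> ?\<phi> a" by simp
      ultimately show ?thesis unfolding ya diff_zero by linarith
    qed
  qed
  define B where "B = norm e * exp (2 * M * (b - a))"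
  have B: "norm (y k t) \<le> B * (1/2)^k" if "t \<in> {a..b}" for k t
  proof -
    have "norm e * exp (2 * M * (t - a)) * (1/2)^k \<le> norm e * exp (2 * M * (b - a)) * (1/2)^k"
      using that M0 by (intro mult_right_mono mult_left_mono) auto
    then show ?thesis using bound[OF that, of k] unfolding B_def by linarith
  qed
  have sumB: "summable (\<lambda>k. B * (1/2)^k)"
    by (intro summable_mult summable_geometric) simp
  define Y where "Y t = (\<Sum>k. y k t)" for t
  have sums: "(\<lambda>k. y k t) sums Y t" if "t \<in> {a..b}" for t
    unfolding Y_def using B[OF that] by (intro summable_sums summable_comparison_test'[OF sumB, of 0]) auto
  have ul: "uniform_limit {a..b} (\<lambda>n t. \<Sum>k<n. y k t) Y sequentially"
    unfolding Y_def by (rule Weierstrass_m_test[OF _ sumB]) (use B in auto)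
  define y' where "y' k t = (case k of 0 \<Rightarrow> 0 | Suc j \<Rightarrow> A t (y j t))" for k t
  have y': "(y k has_vector_derivative y' k t) (at t within {a..b})" if "t \<in> {a..b}" for k t
    using that cont by (cases k) (auto simp: y'_def y0)
  \<comment> \<open>The term \<open>y 0\<close> is constant and each later derivative involves the
    preceding term, so n + 1 derivatives add up to \<open>A t\<close> applied to n terms. The shift
    is undone by \<open>eventually_sequentially_Suc\<close>.\<close>
  have part: "(\<Sum>k<Suc n. y' k t) = A t (\<Sum>k<n. y k t)" for n t
    by (simp only: sum.lessThan_Suc_shift) (simp add: y'_def blinfun.sum_right)
  have "\<exists>g. \<forall>x\<in>{a..b}. (\<lambda>n. y n x) sums g x \<and> (g has_derivative (\<lambda>h. h *\<^sub>R A x (Y x))) (at x within {a..b})"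
  proof (rule has_derivative_series[where f' = "\<lambda>n x h. h *\<^sub>R y' n x" and x = a])
    fix \<epsilon> :: real assume "\<epsilon> > 0"
    then have "\<forall>\<^sub>F n in sequentially. \<forall>x\<in>{a..b}. dist (\<Sum>k<n. y k x) (Y x) < \<epsilon> / M"
      using M0 by (intro uniform_limitD[OF ul]) simp
    then have "\<forall>\<^sub>F n in sequentially. \<forall>x\<in>{a..b}. \<forall>h. norm ((\<Sum>i<Suc n. h *\<^sub>R y' i x) - h *\<^sub>R A x (Y x)) \<le> \<epsilon> * norm h"
    proof eventually_elim
      case (elim n)
      show ?case
      proof (intro ballI allI)
        fix x h assume x: "x \<in> {a..b}"
        have "norm (A x ((\<Sum>k<n. y k x) - Y x)) \<le> norm (A x) * norm ((\<Sum>k<n. y k x) - Y x)"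
          by (rule norm_blinfun)
        also have "\<dots> \<le> M * (\<epsilon> / M)"
          using elim x M[OF x] M0 by (intro mult_mono) (auto simp: dist_norm less_imp_le)
        also have "\<dots> = \<epsilon>" using M0 by simp
        finally have *: "norm (A x ((\<Sum>k<n. y k x) - Y x)) \<le> \<epsilon>" .
        have "(\<Sum>i<Suc n. h *\<^sub>R y' i x) - h *\<^sub>R A x (Y x) = h *\<^sub>R A x ((\<Sum>k<n. y k x) - Y x)"
          by (simp only: scaleR_sum_right[symmetric] part) (simp add: blinfun.diff_right scaleR_diff_right)
        then show "norm ((\<Sum>i<Suc n. h *\<^sub>R y' i x) - h *\<^sub>R A x (Y x)) \<le> \<epsilon> * norm h"
          using mult_right_mono[OF *, of "norm h"] by (simp add: mult.commute)
      qed
    qed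
    then show "\<forall>\<^sub>F n in sequentially. \<forall>x\<in>{a..b}. \<forall>h. norm ((\<Sum>i<n. h *\<^sub>R y' i x) - h *\<^sub>R A x (Y x)) \<le> \<epsilon> * norm h"
      by (rule eventually_sequentially_Suc[THEN iffD1])
  qed (use y' ab sums in \<open>auto simp: has_vector_derivative_def\<close>)
  then obtain g where g: "\<And>x. x \<in> {a..b} \<Longrightarrow> (\<lambda>n. y n x) sums g x"
    "\<And>x. x \<in> {a..b} \<Longrightarrow> (g has_vector_derivative A x (Y x)) (at x within {a..b})"
    unfolding has_vector_derivative_def by blast
  have gY: "g x = Y x" if "x \<in> {a..b}" for x
    using g(1)[OF that] sums[OF that] by (rule sums_unique2)
  have "y n a = (if n = 0 then e else 0)" for n
    by (cases n) (simp_all add: y0 yS)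
  then have "(\<lambda>n. y n a) sums e"
    using sums_single[of 0 "\<lambda>_. e"] by simp
  then have "g a = e" using g(1)[of a] ab by (auto intro: sums_unique2)
  then show ?thesis using g(2) gY by auto
qed

text \<open>Solutions prescribed at \<open>a\<close> suffice: evaluating them at \<open>c\<close> is injective by uniqueness, hence onto.\<close>

lemma linear_ode_exists_Icc:
  fixes A :: "real \<Rightarrow> 'b::euclidean_space \<Rightarrow>\<^sub>L 'b"
  assumes A: "continuous_on {a..b} A" and c: "c \<in> {a..b}"
  shows "\<exists>Y. Y c = e \<and> (\<forall>t\<in>{a..b}. (Y has_vector_derivative A t (Y t)) (at t within {a..b}))"
proof -
  have ab: "a \<le> b" using c by auto
  obtain Y where Y: "\<And>e. Y e a = e"
    "\<And>e t. t \<in> {a..b} \<Longrightarrow> (Y e has_vector_derivative A t (Y e t)) (at t within {a..b})"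
    using linear_ode_exists_left[OF A ab] by metis
  have a: "a \<in> {a..b}" using ab by simp
  have "linear (\<lambda>e. Y e c)"
  proof (rule linearI)
    fix e f r
    show "Y (e + f) c = Y e c + Y f c"
      by (rule linear_ode_unique[OF A _ _ a _ c])
         (auto intro!: Y(2) has_vector_derivative_add simp: Y(1) blinfun.add_right)
    have "((\<lambda>t. r *\<^sub>R Y e t) has_vector_derivative A t (r *\<^sub>R Y e t)) (at t within {a..b})" if "t \<in> {a..b}" for t
      using bounded_linear.has_vector_derivative[OF bounded_linear_scaleR_right Y(2)[OF that]]
      by (simp add: blinfun.scaleR_right)
    from linear_ode_unique[OF A Y(2) this a _ c, of "r *\<^sub>R e"]
    show "Y (r *\<^sub>R e) c = r *\<^sub>R Y e c"
      by (simp add: Y(1))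
  qed
  moreover have "inj (\<lambda>e. Y e c)"
  proof (rule injI)
    fix e f assume "Y e c = Y f c"
    from linear_ode_unique[OF A Y(2) Y(2) c this a] have "Y e a = Y f a"
      by simp
    then show "e = f" by (simp add: Y(1))
  qed
  ultimately have "surj (\<lambda>e. Y e c)" by (rule linear_injective_imp_surjective) (rule refl)
  then obtain f where "Y f c = e" by (metis surjD)
  then show ?thesis using Y(2) by blast
qed

text \<open>Derivatives within \<open>I\<close> are local, so at \<open>t\<close> they can be
  computed within a compact interval that also contains \<open>s\<close>. If \<open>t\<close> is an
  endpoint of \<open>I\<close>, \<open>U\<close> is left unrestricted on the outer side.\<close>

lemma is_interval_relative_nhd_Icc:
  fixes I :: "real set"
  assumes I: "is_interval I" and st: "s \<in> I" "t \<in> I"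
  obtains a b U where "a \<in> I" "b \<in> I" "s \<in> {a..b}" "t \<in> {a..b}" "open U" "t \<in> U" "I \<inter> U \<subseteq> {a..b}" "{a..b} \<subseteq> I"
proof -
  have "\<exists>a U. a \<in> I \<and> a \<le> s \<and> a \<le> t \<and> open U \<and> t \<in> U \<and> (\<forall>x\<in>I \<inter> U. a \<le> x)"
  proof (cases "\<exists>p\<in>I. p < t")
    case True
    then obtain p where p: "p \<in> I" "p < t" by blast
    show ?thesis
      by (rule exI[of _ "min p s"], rule exI[of _ "{p<..}"]) (use p st in \<open>auto simp: min_def\<close>)
  next
    case False
    then show ?thesis using st by (intro exI[of _ t] exI[of _ UNIV]) force
  qed
  moreover have "\<exists>b U. b \<in> I \<and> s \<le> b \<and> t \<le> b \<and> open U \<and> t \<in> U \<and> (\<forall>x\<in>I \<inter> U. x \<le> b)"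
  proof (cases "\<exists>p\<in>I. t < p")
    case True
    then obtain p where p: "p \<in> I" "t < p" by blast
    show ?thesis
      by (rule exI[of _ "max p s"], rule exI[of _ "{..<p}"]) (use p st in \<open>auto simp: max_def\<close>)
  next
    case False
    then show ?thesis using st by (intro exI[of _ t] exI[of _ UNIV]) force
  qed
  ultimately obtain a b U U' where *: "a \<in> I" "a \<le> s" "a \<le> t" "open U" "t \<in> U" "\<forall>x\<in>I \<inter> U. a \<le> x"
    "b \<in> I" "s \<le> b" "t \<le> b" "open U'" "t \<in> U'" "\<forall>x\<in>I \<inter> U'. x \<le> b" by blast
  show thesis
  proof (rule that[of a b "U \<inter> U'"])
    show "{a..b} \<subseteq> I" using mem_is_interval_1_I[OF I *(1,7)] by auto
  qed (use * in auto)
qed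

text \<open>As \<open>I\<close> may be open or unbounded, the solution is glued from solutions on
  the compact intervals between \<open>s\<close> and each \<open>t\<close>, which agree by
  uniqueness.\<close>

lemma linear_ode_exists:
  fixes A :: "real \<Rightarrow> 'b::euclidean_space \<Rightarrow>\<^sub>L 'b"
  assumes I: "is_interval I" and A: "continuous_on I A" and s: "s \<in> I"
  shows "\<exists>Y. Y s = e \<and> (\<forall>t\<in>I. (Y has_vector_derivative A t (Y t)) (at t within I))"
proof -
  have sub: "{min s t..max s t} \<subseteq> I" if "t \<in> I" for t
    using mem_is_interval_1_I[OF I s that] mem_is_interval_1_I[OF I that s] by (auto simp: min_def max_def split: if_splits)
  have "\<forall>t\<in>I. \<exists>Y. Y s = e \<and> (\<forall>u\<in>{min s t..max s t}. (Y has_vector_derivative A u (Y u)) (at u within {min s t..max s t}))"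
    using sub by (intro ballI linear_ode_exists_Icc continuous_on_subset[OF A]) auto
  then obtain Y where Y: "\<And>t. t \<in> I \<Longrightarrow> Y t s = e"
    "\<And>t u. t \<in> I \<Longrightarrow> u \<in> {min s t..max s t} \<Longrightarrow> (Y t has_vector_derivative A u (Y t u)) (at u within {min s t..max s t})"
    by metis
  \<comment> \<open>Each time is evaluated in its own solution; on a relative neighbourhood of any
    \<open>t\<close> in \<open>I\<close> the result coincides with a single solution
    \<open>X\<close>.\<close>
  define Z where "Z t = Y t t" for t
  have "(Z has_vector_derivative A t (Z t)) (at t within I)" if t: "t \<in> I" for t
  proof -
    obtain a b U where ab: "a \<in> I" "b \<in> I" "s \<in> {a..b}" "t \<in> {a..b}" "open U" "t \<in> U" "I \<inter> U \<subseteq> {a..b}" "{a..b} \<subseteq> I"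
      using is_interval_relative_nhd_Icc[OF I s t] by metis
    obtain X where X: "X s = e" "\<And>u. u \<in> {a..b} \<Longrightarrow> (X has_vector_derivative A u (X u)) (at u within {a..b})"
      using linear_ode_exists_Icc[OF continuous_on_subset[OF A ab(8)] ab(3), of e] by blast
    have XZ: "Z u = X u" if u: "u \<in> {a..b}" for u
      unfolding Z_def
    proof (rule linear_ode_unique[where X = "Y u" and Y = X and a = "min s u" and b = "max s u" and s = s and A = A])
      have uI: "u \<in> I" using ab(8) u by blast
      show "continuous_on {min s u..max s u} A"
        using sub[OF uI] by (rule continuous_on_subset[OF A])
      show "Y u s = X s" using Y(1)[OF uI] X(1) by simp
      fix v assume v: "v \<in> {min s u..max s u}"
      show "(Y u has_vector_derivative A v (Y u v)) (at v within {min s u..max s u})"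
        using Y(2)[OF uI v] .
      have sub': "{min s u..max s u} \<subseteq> {a..b}" using ab(3) u by auto
      then have "v \<in> {a..b}" using v by blast
      from has_vector_derivative_within_subset[OF X(2)[OF this] sub']
      show "(X has_vector_derivative A v (X v)) (at v within {min s u..max s u})" .
    qed auto
    have "(Z has_vector_derivative A t (Z t)) (at t within {a..b})"
      by (rule has_vector_derivative_transform[OF ab(4), of Z X]) (use X(2)[OF ab(4)] XZ ab(4) in auto)
    moreover have "at t within I = at t within {a..b}"
      by (rule at_within_nhd[OF ab(6,5)]) (use ab in auto)
    ultimately show ?thesis by simp
  qed
  moreover have "Z s = e" using Y(1)[OF s] by (simp add: Z_def)
  ultimately show ?thesis by blast
qed

section \<open>Linear algebra and finite orders\<close>

lemma sum_fun_apply: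
  fixes f :: "'i \<Rightarrow> 'x \<Rightarrow> 'b::comm_monoid_add"
  shows "(\<Sum>i\<in>A. f i) x = (\<Sum>i\<in>A. f i x)"
  by (induction A rule: infinite_finite_induct) auto

text \<open>Gaussian elimination, by induction on the equations: one with zero coefficients is
  dropped, any other eliminates a pivot unknown \<open>p\<close>, whose value \<open>q\<close> is
  recovered from it.\<close>

lemma homogeneous_system_nontrivial_solution:
  fixes M :: "'i \<Rightarrow> 'j \<Rightarrow> 'k::field"
  assumes "finite B" "finite A" "card B < card A"
  shows "\<exists>c. (\<exists>a\<in>A. c a \<noteq> 0) \<and> (\<forall>b\<in>B. (\<Sum>a\<in>A. c a * M a b) = 0)"
  using assms
proof (induction B arbitrary: A M rule: finite_induct)
  case empty
  then have "A \<noteq> {}" by auto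
  then show ?case by (intro exI[of _ "\<lambda>_. 1"]) auto
next
  case (insert b B)
  show ?case
  proof (cases "\<forall>a\<in>A. M a b = 0")
    case True
    moreover obtain c where "\<exists>a\<in>A. c a \<noteq> 0" "\<forall>b\<in>B. (\<Sum>a\<in>A. c a * M a b) = 0"
      using insert.IH[of A M] insert.prems insert.hyps by auto
    ultimately show ?thesis by (intro exI[of _ c]) auto
  next
    case False
    then obtain p where p: "p \<in> A" "M p b \<noteq> 0" by blast
    define A' where "A' = A - {p}"
    have A': "finite A'" "A = insert p A'" "p \<notin> A'" "card B < card A'"
      using insert.prems insert.hyps p(1) by (auto simp: A'_def insert_absorb card_Diff_singleton)
    obtain c where c: "\<exists>a\<in>A'. c a \<noteq> 0"
        "\<forall>d\<in>B. (\<Sum>a\<in>A'. c a * (M a d - M a b / M p b * M p d)) = 0"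
      using insert.IH[of A' "\<lambda>a d. M a d - M a b / M p b * M p d"] A'(1,4) by blast
    define q where "q = - (\<Sum>a\<in>A'. c a * M a b) / M p b"
    define c' where "c' = c(p := q)"
    have sum: "(\<Sum>a\<in>A. c' a * M a d) = q * M p d + (\<Sum>a\<in>A'. c a * M a d)" for d
    proof -
      have "(\<Sum>a\<in>A'. c' a * M a d) = (\<Sum>a\<in>A'. c a * M a d)"
        using A'(3) by (intro sum.cong) (auto simp: c'_def)
      then show ?thesis using A'(1-3) by (simp add: c'_def)
    qed
    have "(\<Sum>a\<in>A. c' a * M a d) = 0" if "d \<in> insert b B" for d
    proof (cases "d = b")
      case True
      then show ?thesis using p(2) by (simp add: sum q_def)
    next
      case False
      then have "0 = (\<Sum>a\<in>A'. c a * (M a d - M a b / M p b * M p d))" using c(2) that by auto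
      also have "\<dots> = (\<Sum>a\<in>A'. c a * M a d) - (\<Sum>a\<in>A'. c a * M a b) / M p b * M p d"
        by (simp add: right_diff_distrib sum_subtractf sum_distrib_right sum_divide_distrib mult.assoc)
      finally show ?thesis by (simp add: sum q_def)
    qed
    moreover have "\<exists>a\<in>A. c' a \<noteq> 0" using c(1) A'(2,3) by (auto simp: c'_def)
    ultimately show ?thesis by blast
  qed
qed

text \<open>A basis \<open>D\<close> of the intersection is extended to bases of both spaces, and
  the added vectors form \<open>C\<close> and \<open>G\<close>. The dimension balance is additive to
  avoid truncated subtraction; finiteness concerns independent subsets because the ambient space may
  have infinite dimension.\<close>

lemma relative_complement_bases:
  fixes W W' :: "'v::real_vector set"
  assumes W: "subspace W" "subspace W'"
    and fin: "\<And>B. B \<subseteq> W \<Longrightarrow> independent B \<Longrightarrow> finite B" "\<And>B. B \<subseteq> W' \<Longrightarrow> independent B \<Longrightarrow> finite B"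
  shows "\<exists>C G. finite C \<and> finite G \<and> C \<subseteq> W \<and> G \<subseteq> W' \<and> dim W + card G = dim W' + card C \<and>
      (\<forall>c. (\<Sum>x\<in>C. c x *\<^sub>R x) \<in> W' \<longrightarrow> (\<forall>x\<in>C. c x = 0)) \<and> W' \<subseteq> span (G \<union> (W \<inter> W'))"
proof -
  obtain D where D: "D \<subseteq> W \<inter> W'" "independent D" "W \<inter> W' \<subseteq> span D"
    using maximal_independent_subset[of "W \<inter> W'"] by metis
  obtain B where B: "D \<subseteq> B" "B \<subseteq> W" "independent B" "W \<subseteq> span B"
    using maximal_independent_subset_extend[of D W] D by auto
  obtain B' where B': "D \<subseteq> B'" "B' \<subseteq> W'" "independent B'" "W' \<subseteq> span B'"
    using maximal_independent_subset_extend[of D W'] D by auto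
  have finB: "finite B" "finite B'" using fin B B' by auto
  have finD: "finite D" using finB(1) B(1) by (rule rev_finite_subset)
  have "dim W = card D + card (B - D)" "dim W' = card D + card (B' - D)"
    using basis_card_eq_dim[OF B(2,4,3)] basis_card_eq_dim[OF B'(2,4,3)] finD B(1) B'(1)
      card_mono[OF finB(1) B(1)] card_mono[OF finB(2) B'(1)]
    by (simp_all add: card_Diff_subset)
  moreover have "\<forall>x\<in>B - D. c x = 0" if "(\<Sum>x\<in>B - D. c x *\<^sub>R x) \<in> W'" for c
  proof -
    have "(\<Sum>x\<in>B - D. c x *\<^sub>R x) \<in> W"
      using B(2) by (intro subspace_sum[OF W(1)] subspace_scale[OF W(1)]) auto
    then have "(\<Sum>x\<in>B - D. c x *\<^sub>R x) \<in> span D" using that D(3) by auto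
    then obtain d where d: "(\<Sum>x\<in>B - D. c x *\<^sub>R x) = (\<Sum>x\<in>D. d x *\<^sub>R x)"
      unfolding span_finite[OF finD] by blast
    \<comment> \<open>The combination lies in the intersection; moving its expansion over
      \<open>D\<close> to the other side gives a linear relation in the independent set
      \<open>B\<close>.\<close>
    define e where "e x = (if x \<in> D then - d x else c x)" for x
    have "(\<Sum>x\<in>B. e x *\<^sub>R x) = (\<Sum>x\<in>B - D. e x *\<^sub>R x) + (\<Sum>x\<in>D. e x *\<^sub>R x)"
      by (rule sum.subset_diff[OF B(1) finB(1)])
    also have "(\<Sum>x\<in>B - D. e x *\<^sub>R x) = (\<Sum>x\<in>B - D. c x *\<^sub>R x)"
      by (intro sum.cong) (auto simp: e_def)
    also have "(\<Sum>x\<in>D. e x *\<^sub>R x) = - (\<Sum>x\<in>D. d x *\<^sub>R x)"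
      by (simp add: e_def sum_negf)
    finally have "(\<Sum>x\<in>B. e x *\<^sub>R x) = 0" by (simp add: d)
    then have "e x = 0" if "x \<in> B" for x
      using independentD[OF B(3) finB(1) order_refl _ that] by blast
    then show ?thesis by (auto simp: e_def) (metis)
  qed
  moreover have "W' \<subseteq> span ((B' - D) \<union> (W \<inter> W'))"
    using B'(4) by (rule order_trans) (intro span_mono, use D in auto)
  ultimately show ?thesis
    using finB B B' by (intro exI[of _ "B - D"] exI[of _ "B' - D"]) auto
qed

text \<open>Induction on the number of elements strictly between \<open>s\<close> and
  \<open>t\<close>; this chains comparisons between consecutive times.\<close>

lemma monotone_on_finite_set:
  fixes f :: "'i::linorder \<Rightarrow> 'j::preorder"
  assumes T: "finite T"
    and step: "\<And>s t. s \<in> T \<Longrightarrow> t \<in> T \<Longrightarrow> s < t \<Longrightarrow> (\<And>u. u \<in> T \<Longrightarrow> \<not> (s < u \<and> u < t)) \<Longrightarrow> f s \<le> f t"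
    and st: "s \<in> T" "t \<in> T" "s \<le> t"
  shows "f s \<le> f t"
  using st
proof (induction "card {u \<in> T. s < u \<and> u < t}" arbitrary: s t rule: less_induct)
  case less
  show ?case
  proof (cases "s = t \<or> (\<forall>u\<in>T. \<not> (s < u \<and> u < t))")
    case True
    then show ?thesis using step[of s t] less.prems by (cases "s = t") auto
  next
    case False
    then obtain u where u: "u \<in> T" "s < u" "u < t" by blast
    have "{v \<in> T. s < v \<and> v < u} \<subset> {v \<in> T. s < v \<and> v < t}" "{v \<in> T. u < v \<and> v < t} \<subset> {v \<in> T. s < v \<and> v < t}"
      using u by (auto dest: less_trans)
    then have "f s \<le> f u" "f u \<le> f t"
      using less u T by (auto intro!: less.hyps psubset_card_mono)
    then show ?thesis by (rule order_trans)
  qed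
qed

section \<open>Jacobi fields and Lagrangian subspaces\<close>

text \<open>The map (v, w) \<mapsto> (w, -A v) of the equivalent first-order system, composed from
  bounded operators so that continuity in \<open>A\<close> is immediate.\<close>

definition phase_generator :: "('a::euclidean_space \<Rightarrow>\<^sub>L 'a) \<Rightarrow> ('a \<times> 'a) \<Rightarrow>\<^sub>L ('a \<times> 'a)" where
  "phase_generator A = Blinfun (\<lambda>p. (snd p, 0)) - (Blinfun (\<lambda>v. (0, v)) o\<^sub>L A o\<^sub>L Blinfun fst)"

lemma phase_generator_apply: "phase_generator A p = (snd p, - A (fst p))"
proof -
  have "bounded_linear (\<lambda>p::'a \<times> 'a. (snd p, 0::'a))" "bounded_linear (\<lambda>v::'a. (0::'a, v))"
    by (intro bounded_linear_Pair bounded_linear_snd bounded_linear_zero bounded_linear_ident)+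
  then show ?thesis
    by (simp add: phase_generator_def bounded_linear_Blinfun_apply bounded_linear_fst blinfun.diff_left)
qed

lemma continuous_on_phase_generator:
  "continuous_on S f \<Longrightarrow> continuous_on S (\<lambda>t. phase_generator (f t))"
  unfolding phase_generator_def by (intro continuous_intros)

section \<open>Jacobi fields: existence, uniqueness and linearization\<close>

locale jacobi_equation =
  fixes I :: "real set" and R :: "real \<Rightarrow> 'a::euclidean_space \<Rightarrow>\<^sub>L 'a"
  assumes interval: "is_interval I" and nondegenerate: "interior I \<noteq> {}"
    and continuous: "continuous_on I R"
    and symmetric: "\<And>t. t \<in> I \<Longrightarrow> symmetric_endo (R t)"
begin

definition velocity :: "(real \<Rightarrow> 'a) \<Rightarrow> real \<Rightarrow> 'a" where
  "velocity J t = vector_derivative J (at t within I)"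

lemma velocity_eqI:
  "t \<in> I \<Longrightarrow> (J has_vector_derivative v) (at t within I) \<Longrightarrow> velocity J t = v"
  unfolding velocity_def
  using nondegenerate_interval_at_within[OF interval nondegenerate] by (simp add: vector_derivative_within)

lemma Jac_has_vector_derivative:
  assumes J: "J \<in> Jac I R" and t: "t \<in> I"
  shows "(J has_vector_derivative velocity J t) (at t within I)"
    and "(velocity J has_vector_derivative - R t (J t)) (at t within I)"
proof -
  obtain J' where J': "\<And>t. t \<in> I \<Longrightarrow> (J has_vector_derivative J' t) (at t within I)"
    "\<And>t. t \<in> I \<Longrightarrow> (J' has_vector_derivative - R t (J t)) (at t within I)"
    using J by (auto simp: Jac_def)
  then have v: "velocity J u = J' u" if "u \<in> I" for u
    using that by (intro velocity_eqI)
  show "(J has_vector_derivative velocity J t) (at t within I)" using J'(1)[OF t] v[OF t] by simp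
  show "(velocity J has_vector_derivative - R t (J t)) (at t within I)"
    by (rule has_vector_derivative_transform[OF t _ J'(2)[OF t]]) (rule v)
qed

lemma Jac_has_vector_derivative_phase:
  assumes "J \<in> Jac I R" "t \<in> I"
  shows "((\<lambda>t. (J t, velocity J t)) has_vector_derivative phase_generator (R t) (J t, velocity J t)) (at t within I)"
  using Jac_has_vector_derivative[OF assms]
  by (simp add: phase_generator_apply has_vector_derivative_Pair)

lemma Jac_exists:
  assumes t: "t \<in> I"
  shows "\<exists>J\<in>Jac I R. J t = v \<and> velocity J t = w"
proof -
  obtain Y where Y: "Y t = (v, w)"
    "\<And>u. u \<in> I \<Longrightarrow> (Y has_vector_derivative phase_generator (R u) (Y u)) (at u within I)"
    using linear_ode_exists[OF interval continuous_on_phase_generator[OF continuous] t] by metis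
  \<comment> \<open>The position component, cut off outside \<open>I\<close> as the representation
    in \<open>Jac\<close> demands.\<close>
  define J where "J u = (if u \<in> I then fst (Y u) else 0)" for u
  have J: "(J has_vector_derivative snd (Y u)) (at u within I)"
    "((\<lambda>u. snd (Y u)) has_vector_derivative - R u (J u)) (at u within I)" if u: "u \<in> I" for u
  proof -
    have "((\<lambda>u. fst (Y u)) has_vector_derivative snd (Y u)) (at u within I)"
      using bounded_linear.has_vector_derivative[OF bounded_linear_fst Y(2)[OF u]]
      by (simp add: phase_generator_apply)
    then show "(J has_vector_derivative snd (Y u)) (at u within I)"
      by (rule has_vector_derivative_transform[OF u, rotated]) (simp add: J_def)
    show "((\<lambda>u. snd (Y u)) has_vector_derivative - R u (J u)) (at u within I)"
      using bounded_linear.has_vector_derivative[OF bounded_linear_snd Y(2)[OF u]] u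
      by (simp add: phase_generator_apply J_def)
  qed
  have "J \<in> Jac I R"
    unfolding Jac_def mem_Collect_eq using J by (intro conjI exI[of _ "\<lambda>u. snd (Y u)"]) (auto simp: J_def)
  moreover have "velocity J t = w" using velocity_eqI[OF t J(1)[OF t]] Y(1) by simp
  moreover have "J t = v" using t Y(1) by (simp add: J_def)
  ultimately show ?thesis by blast
qed

lemma Jac_eqI:
  assumes J: "J \<in> Jac I R" and K: "K \<in> Jac I R" and t: "t \<in> I"
    and eq: "J t = K t" "velocity J t = velocity K t"
  shows "J = K"
proof
  fix u
  show "J u = K u"
  proof (cases "u \<in> I")
    case False
    then show ?thesis using J K by (simp add: Jac_def)
  next
    case True
    have sub: "{min t u..max t u} \<subseteq> I"
      using mem_is_interval_1_I[OF interval t True] mem_is_interval_1_I[OF interval True t]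
      by (auto simp: min_def max_def split: if_splits)
    note D = has_vector_derivative_within_subset[OF Jac_has_vector_derivative_phase sub]
    have "(J u, velocity J u) = (K u, velocity K u)"
    proof (rule linear_ode_unique[where X = "\<lambda>t. (J t, velocity J t)" and Y = "\<lambda>t. (K t, velocity K t)" and s = t])
      show "continuous_on {min t u..max t u} (\<lambda>t. phase_generator (R t))"
        using continuous sub by (intro continuous_on_phase_generator) (rule continuous_on_subset)
    qed (use D J K sub eq in auto)
    then show ?thesis by simp
  qed
qed

lemma velocity_add:
  assumes "J \<in> Jac I R" "K \<in> Jac I R" "t \<in> I"
  shows "velocity (J + K) t = velocity J t + velocity K t"
  unfolding plus_fun_def using assms
  by (intro velocity_eqI has_vector_derivative_add Jac_has_vector_derivative)

lemma velocity_diff: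
  assumes "J \<in> Jac I R" "K \<in> Jac I R" "t \<in> I"
  shows "velocity (J - K) t = velocity J t - velocity K t"
  unfolding fun_diff_def using assms
  by (intro velocity_eqI has_vector_derivative_diff Jac_has_vector_derivative)

lemma velocity_scaleR:
  assumes "J \<in> Jac I R" "t \<in> I"
  shows "velocity (c *\<^sub>R J) t = c *\<^sub>R velocity J t"
  unfolding scaleR_fun_def using assms
  by (intro velocity_eqI bounded_linear.has_vector_derivative[OF bounded_linear_scaleR_right] Jac_has_vector_derivative)

lemma velocity_zero: "t \<in> I \<Longrightarrow> velocity 0 t = 0"
  unfolding zero_fun_def by (intro velocity_eqI has_vector_derivative_const)

lemma velocity_sum:
  assumes "\<And>i. i \<in> A \<Longrightarrow> J i \<in> Jac I R" "t \<in> I"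
  shows "velocity (\<Sum>i\<in>A. J i) t = (\<Sum>i\<in>A. velocity (J i) t)"
  using assms
  by (induction A rule: infinite_finite_induct)
     (simp_all add: velocity_zero velocity_add subspace_sum[OF subspace_Jac])

lemma omega_eq:
  assumes "J \<in> Jac I R" "K \<in> Jac I R" "t \<in> I"
  shows "omega I J K = J t \<bullet> velocity K t - velocity J t \<bullet> K t"
  using omega_eq_wronskian_at[OF interval nondegenerate symmetric assms]
  by (simp add: wronskian_at_def velocity_def)

text \<open>Growth in phase space bounds \<open>J\<close> and its velocity by the data at
  \<open>s\<close>; hence the acceleration is bounded, and two mean value estimates give the
  quadratic remainder. One constant serves all \<open>J\<close>, as needed for fields that vary with
  the time.\<close>

lemma Jac_linearization:
  assumes sub: "{a..b} \<subseteq> I" and s: "s \<in> {a..b}"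
  obtains C where "C \<ge> 0"
    "\<And>J t. J \<in> Jac I R \<Longrightarrow> t \<in> {a..b} \<Longrightarrow> norm (velocity J t) \<le> C * (norm (J s) + norm (velocity J s))"
    "\<And>J t. J \<in> Jac I R \<Longrightarrow> t \<in> {a..b} \<Longrightarrow>
      norm (J t - J s - (t - s) *\<^sub>R velocity J s) \<le> C * (norm (J s) + norm (velocity J s)) * \<bar>t - s\<bar>\<^sup>2"
proof -
  have "bounded (R ` {a..b})" "bounded ((\<lambda>t. phase_generator (R t)) ` {a..b})"
    using continuous_on_subset[OF continuous sub]
    by (auto intro!: compact_imp_bounded compact_continuous_image continuous_on_phase_generator)
  then obtain M1 M2 where M1: "M1 > 0" "\<forall>x\<in>R ` {a..b}. norm x \<le> M1"
    and M2: "M2 > 0" "\<forall>x\<in>(\<lambda>t. phase_generator (R t)) ` {a..b}. norm x \<le> M2"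
    unfolding bounded_pos by metis
  define E where "E = exp (M2 * (b - a))"
  have E: "E > 0" by (simp add: E_def)
  have main: "norm (velocity J t) \<le> E * N \<and> norm (J t - J s - (t - s) *\<^sub>R velocity J s) \<le> 3 * M1 * E * N * \<bar>t - s\<bar>\<^sup>2"
    if J: "J \<in> Jac I R" and t: "t \<in> {a..b}" and N: "N = norm (J s) + norm (velocity J s)" for J t N
  proof -
    have growth: "norm (J u, velocity J u) \<le> E * N" if u: "u \<in> {a..b}" for u
    proof -
      have "norm (J u, velocity J u) \<le> exp (M2 * \<bar>u - s\<bar>) * norm (J s, velocity J s)"
      proof (rule linear_ode_growth[where Y = "\<lambda>t. (J t, velocity J t)" and A = "\<lambda>t. phase_generator (R t)", OF _ _ s u])
        fix t assume "t \<in> {a..b}"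
        then show "((\<lambda>t. (J t, velocity J t)) has_vector_derivative phase_generator (R t) (J t, velocity J t)) (at t within {a..b})"
          using sub by (intro has_vector_derivative_within_subset[OF Jac_has_vector_derivative_phase[OF J] sub]) auto
      qed (use M2 in auto)
      also have "\<dots> \<le> E * N"
        unfolding E_def N using s u M2(1) norm_Pair_le[of "J s" "velocity J s"]
        by (intro mult_mono) auto
      finally show ?thesis .
    qed
    have v: "norm (velocity J u) \<le> E * N" and p: "norm (J u) \<le> E * N" if "u \<in> {a..b}" for u
      using growth[OF that] norm_snd_le[of "velocity J u" "J u"] norm_fst_le[of "J u" "velocity J u"] by linarith+
    define S where "S = closed_segment s t"
    have S: "S \<subseteq> {a..b}" "s \<in> S" "closed_segment s u \<subseteq> S" "\<bar>u - s\<bar> \<le> \<bar>t - s\<bar>" if "u \<in> S" for u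
      using s t that by (auto simp: S_def closed_segment_eq_real_ivl split: if_splits)
    have tS: "t \<in> S" by (simp add: S_def)
    have SI: "S \<subseteq> I" using S(1)[OF tS] sub by blast
    note D = has_vector_derivative_within_subset[OF Jac_has_vector_derivative(1)[OF J] SI]
       has_vector_derivative_within_subset[OF Jac_has_vector_derivative(2)[OF J] SI]
    have acc: "norm (- R u (J u)) \<le> M1 * (E * N)" if "u \<in> S" for u
    proof -
      have u: "u \<in> {a..b}" using S(1)[OF that] that by blast
      have "norm (R u (J u)) \<le> norm (R u) * norm (J u)" by (rule norm_blinfun)
      also have "\<dots> \<le> M1 * (E * N)" using M1 p[OF u] u by (intro mult_mono) auto
      finally show ?thesis by simp
    qed
    \<comment> \<open>The deviation of the acceleration from its value at \<open>s\<close>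
      contributes 2, the restored linear term 1: hence the factor 3.\<close>
    have vel: "norm (velocity J u - velocity J s) \<le> 3 * M1 * E * N * \<bar>t - s\<bar>" if u: "u \<in> S" for u
    proof -
      have "norm (velocity J u - velocity J s - (u - s) *\<^sub>R (- R s (J s))) \<le> norm (u - s) * (2 * (M1 * (E * N)))"
      proof (rule vector_differentiable_bound_linearization[where S = S])
        fix x assume x: "x \<in> S"
        show "(velocity J has_vector_derivative - R x (J x)) (at x within S)" using D(2) x SI by blast
        show "norm (- R x (J x) - - R s (J s)) \<le> 2 * (M1 * (E * N))"
          using norm_triangle_ineq4[of "- R x (J x)" "- R s (J s)"] acc[OF x] acc[OF S(2)[OF x]] by linarith
      qed (use S u in auto)
      moreover have "norm ((u - s) *\<^sub>R (- R s (J s))) \<le> norm (u - s) * (M1 * (E * N))"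
        using mult_left_mono[OF acc[OF S(2)[OF u]], of "norm (u - s)"] by simp
      ultimately have "norm (velocity J u - velocity J s) \<le> norm (u - s) * (3 * (M1 * (E * N)))"
        using norm_triangle_sub[of "velocity J u - velocity J s" "(u - s) *\<^sub>R (- R s (J s))"] by linarith
      also have "\<dots> \<le> \<bar>t - s\<bar> * (3 * (M1 * (E * N)))"
        using S(4)[OF u] M1(1) E N by (intro mult_right_mono) auto
      finally show ?thesis by (simp add: mult_ac)
    qed
    have "norm (J t - J s - (t - s) *\<^sub>R velocity J s) \<le> norm (t - s) * (3 * M1 * E * N * \<bar>t - s\<bar>)"
    proof (rule vector_differentiable_bound_linearization[where S = S])
      fix x assume x: "x \<in> S"
      show "(J has_vector_derivative velocity J x) (at x within S)" using D(1) x SI by blast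
    qed (use S tS vel in auto)
    then show ?thesis using v[OF t] by (simp add: power2_eq_square mult_ac)
  qed
  have CE: "E * N \<le> (E + 3 * M1 * E) * N" "3 * M1 * E * N * r \<le> (E + 3 * M1 * E) * N * r" if "N \<ge> 0" "r \<ge> 0" for N r
    using that E M1(1) by (auto intro!: mult_right_mono)
  show thesis
  proof (rule that[of "E + 3 * M1 * E"])
    fix J t assume "J \<in> Jac I R" "t \<in> {a..b}"
    note * = main[OF this refl]
    show "norm (velocity J t) \<le> (E + 3 * M1 * E) * (norm (J s) + norm (velocity J s))"
      using * by (intro order_trans[OF _ CE(1)]) auto
    show "norm (J t - J s - (t - s) *\<^sub>R velocity J s) \<le> (E + 3 * M1 * E) * (norm (J s) + norm (velocity J s)) * \<bar>t - s\<bar>\<^sup>2"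
      using * by (intro order_trans[OF _ CE(2)]) auto
  qed (use E M1(1) in auto)
qed

section \<open>Lagrangian subspaces and their values at a time\<close>

lemma lagrangianD:
  assumes "lagrangian I R \<Lambda>"
  shows "subspace \<Lambda>" "J \<in> \<Lambda> \<Longrightarrow> J \<in> Jac I R"
    "J \<in> \<Lambda> \<Longrightarrow> K \<in> \<Lambda> \<Longrightarrow> omega I J K = 0"
    "J \<in> Jac I R \<Longrightarrow> (\<And>K. K \<in> \<Lambda> \<Longrightarrow> omega I J K = 0) \<Longrightarrow> J \<in> \<Lambda>"
proof -
  have *: "subspace \<Lambda>" "\<Lambda> \<subseteq> Jac I R" "\<Lambda> = omega_complement I R \<Lambda>"
    using assms by (auto simp: lagrangian_def)
  show "subspace \<Lambda>" "J \<in> \<Lambda> \<Longrightarrow> J \<in> Jac I R" using * by auto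
  have "J \<in> \<Lambda> \<longleftrightarrow> J \<in> Jac I R \<and> (\<forall>K\<in>\<Lambda>. omega I J K = 0)" for J
    by (subst *(3)) (simp add: omega_complement_def)
  then show "J \<in> \<Lambda> \<Longrightarrow> K \<in> \<Lambda> \<Longrightarrow> omega I J K = 0"
    "J \<in> Jac I R \<Longrightarrow> (\<And>K. K \<in> \<Lambda> \<Longrightarrow> omega I J K = 0) \<Longrightarrow> J \<in> \<Lambda>" by blast+
qed

lemma lagrangian_velocity_orthogonal:
  assumes L: "lagrangian I R \<Lambda>" and "J \<in> \<Lambda>" "K \<in> \<Lambda>" "t \<in> I" "J t = 0"
  shows "K t \<bullet> velocity J t = 0"
  using lagrangianD(3)[OF L assms(2,3)] omega_eq[of J K t] assms lagrangianD(2)[OF L]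
  by (simp add: inner_commute)

text \<open>Split \<open>v\<close> into a value \<open>y\<close> of \<Lambda> at \<open>t\<close>
  and a vector \<open>z\<close> orthogonal to all such values. The field with value 0 and velocity
  \<open>z\<close> is \<omega>-orthogonal to \<Lambda>, hence in \<Lambda> by maximality; so
  \<open>z\<close> is orthogonal to \<open>v\<close> as well as to \<open>y\<close>, and
  vanishes.\<close>

lemma lagrangian_evaluation_surjective:
  assumes L: "lagrangian I R \<Lambda>" and t: "t \<in> I"
    and v: "\<And>J. J \<in> \<Lambda> \<Longrightarrow> J t = 0 \<Longrightarrow> v \<bullet> velocity J t = 0"
  shows "\<exists>K\<in>\<Lambda>. K t = v"
proof -
  let ?U = "(\<lambda>K. K t) ` \<Lambda>"
  have "subspace ?U"
    using lagrangianD(1)[OF L] by (intro linear_subspace_image) (auto intro: linearI)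
  then have span: "span ?U = ?U" by (simp add: span_eq_iff)
  obtain y z where yz: "y \<in> ?U" "\<And>w. w \<in> ?U \<Longrightarrow> orthogonal z w" "v = y + z"
    using orthogonal_subspace_decomp_exists[of ?U v] unfolding span by metis
  obtain J where J: "J \<in> Jac I R" "J t = 0" "velocity J t = z"
    using Jac_exists[OF t] by blast
  have "J \<in> \<Lambda>"
  proof (rule lagrangianD(4)[OF L J(1)])
    fix K assume K: "K \<in> \<Lambda>"
    then show "omega I J K = 0"
      using omega_eq[OF J(1) lagrangianD(2)[OF L K] t] yz(2)[of "K t"] J by (simp add: orthogonal_def)
  qed
  then have "v \<bullet> z = 0" using v J by auto
  moreover have "y \<bullet> z = 0" using yz(1,2) by (auto simp: orthogonal_def inner_commute)
  ultimately have "z = 0" using yz(3) by (simp add: inner_add_left)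
  then show ?thesis using yz by auto
qed

section \<open>Comparison of a Jacobi field with a Lagrangian subspace\<close>

text \<open>With \<open>\<tau> = \<bar>t - s\<bar>\<close>, up to terms controlled by \<open>norm (K s)\<close> the velocity of \<open>K\<close> at \<open>s\<close> is a vector \<open>w2\<close>
  orthogonal to \<open>K s\<close>, so \<open>K t\<close> has norm at least a multiple of \<open>norm (K s) + \<tau> * norm w2\<close>.\<close>

lemma lagrangian_velocity_bound:
  assumes L: "lagrangian I R \<Lambda>" and sub: "{a..b} \<subseteq> I" and s: "s \<in> {a..b}"
  obtains C \<delta> where "C \<ge> 0" "\<delta> > 0"
    "\<And>K t. K \<in> \<Lambda> \<Longrightarrow> t \<in> {a..b} \<Longrightarrow> \<bar>t - s\<bar> < \<delta> \<Longrightarrow> \<bar>t - s\<bar> * norm (velocity K t) \<le> C * norm (K t)"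
    "\<And>K t. K \<in> \<Lambda> \<Longrightarrow> t \<in> {a..b} \<Longrightarrow> \<bar>t - s\<bar> < \<delta> \<Longrightarrow> \<forall>J\<in>\<Lambda>. J s = 0 \<longrightarrow> J = 0 \<Longrightarrow>
      norm (velocity K t) \<le> C * norm (K t)"
proof -
  have sI: "s \<in> I" using sub s by blast
  define V where "V = (\<lambda>J. (J s, velocity J s)) ` \<Lambda>"
  have V: "subspace V"
  proof (rule subspaceI)
    show "0 \<in> V"
      unfolding V_def by (rule image_eqI[of _ _ 0])
        (simp_all add: zero_prod_def velocity_zero sI subspace_0 lagrangianD(1)[OF L])
  next
    fix x y assume "x \<in> V" "y \<in> V"
    then obtain J K where JK: "J \<in> \<Lambda>" "K \<in> \<Lambda>" "x = (J s, velocity J s)" "y = (K s, velocity K s)"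
      by (auto simp: V_def)
    show "x + y \<in> V"
      unfolding V_def by (rule image_eqI[of _ _ "J + K"])
        (use JK sI in \<open>simp_all add: velocity_add subspace_add lagrangianD(1,2)[OF L]\<close>)
  next
    fix c x assume "x \<in> V"
    then obtain J where J: "J \<in> \<Lambda>" "x = (J s, velocity J s)" by (auto simp: V_def)
    show "c *\<^sub>R x \<in> V"
      unfolding V_def by (rule image_eqI[of _ _ "c *\<^sub>R J"])
        (use J sI in \<open>simp_all add: velocity_scaleR subspace_scale lagrangianD(1,2)[OF L]\<close>)
  qed
  \<comment> \<open>\<open>g\<close> selects linearly, for each value of \<Lambda> at
    \<open>s\<close>, initial data of a field of \<Lambda>; its operator bound \<open>B\<close>
    controls the selected velocity by the value.\<close>
  obtain g where g: "range g \<subseteq> V" "linear g" "\<forall>v\<in>fst ` V. fst (g v) = v"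
    using linear_exists_right_inverse_on[OF bounded_linear.linear[OF bounded_linear_fst] V] by blast
  obtain B where B: "B > 0" "\<And>v. norm (g v) \<le> norm v * B"
    using bounded_linear.pos_bounded[OF linear_conv_bounded_linear[THEN iffD1, OF g(2)]] by blast
  \<comment> \<open>\<open>K'\<close> is the selected field with value \<open>K s\<close>. The
    difference \<open>K - K'\<close> vanishes at \<open>s\<close>, so its velocity \<open>w2\<close>
    is orthogonal to \<open>K s\<close>, and is zero if \<open>s\<close> is not focal.\<close>
  have decomp: "\<exists>w2. K s \<bullet> w2 = 0 \<and> norm (velocity K s - w2) \<le> B * norm (K s)
      \<and> ((\<forall>J\<in>\<Lambda>. J s = 0 \<longrightarrow> J = 0) \<longrightarrow> w2 = 0)" if K: "K \<in> \<Lambda>" for K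
  proof -
    obtain K' where K': "K' \<in> \<Lambda>" "g (K s) = (K' s, velocity K' s)"
      using g(1) by (force simp: V_def)
    have "(K s, velocity K s) \<in> V" using K by (auto simp: V_def)
    then have eq: "K' s = K s" using g(3) K'(2) by force
    have D: "K - K' \<in> \<Lambda>" "(K - K') s = 0" "velocity (K - K') s = velocity K s - velocity K' s"
      using K K'(1) eq sI lagrangianD(2)[OF L] by (auto simp: velocity_diff subspace_diff lagrangianD(1)[OF L])
    show ?thesis
    proof (intro exI[of _ "velocity (K - K') s"] conjI impI)
      show "K s \<bullet> velocity (K - K') s = 0"
        using lagrangian_velocity_orthogonal[OF L D(1) K sI D(2)] .
      have "norm (velocity K' s) \<le> norm (g (K s))" unfolding K'(2) by (rule norm_snd_le)
      then show "norm (velocity K s - velocity (K - K') s) \<le> B * norm (K s)"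
        using B(2)[of "K s"] unfolding D(3) by (simp add: mult.commute)
      assume "\<forall>J\<in>\<Lambda>. J s = 0 \<longrightarrow> J = 0"
      then have "K - K' = 0" using D by blast
      then show "velocity (K - K') s = 0" using velocity_zero[OF sI] by metis
    qed
  qed
  obtain C where C: "C \<ge> 0" "\<And>J t. J \<in> Jac I R \<Longrightarrow> t \<in> {a..b} \<Longrightarrow>
      norm (velocity J t) \<le> C * (norm (J s) + norm (velocity J s))"
      "\<And>J t. J \<in> Jac I R \<Longrightarrow> t \<in> {a..b} \<Longrightarrow>
      norm (J t - J s - (t - s) *\<^sub>R velocity J s) \<le> C * (norm (J s) + norm (velocity J s)) * \<bar>t - s\<bar>\<^sup>2"
    using Jac_linearization[OF sub s] by metis
  \<comment> \<open>\<open>D\<close> dominates the constants at once. The radius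
    \<open>1 / (8 * D)\<close> makes each of two error terms at most an eighth of \<alpha> + \<tau>
    \<beta>, so a quarter of it survives from the lower bound by one half.\<close>
  define D where "D = C * (1 + B) + B + 1"
  have D: "D \<ge> 1" "B \<le> D" "C * (1 + B) \<le> D" using C(1) B(1) by (auto simp: D_def)
  have main: "\<bar>t - s\<bar> * norm (velocity K t) \<le> 4 * D * norm (K t) \<and>
      ((\<forall>J\<in>\<Lambda>. J s = 0 \<longrightarrow> J = 0) \<longrightarrow> norm (velocity K t) \<le> 4 * D * norm (K t))"
    if K: "K \<in> \<Lambda>" and t: "t \<in> {a..b}" and near: "\<bar>t - s\<bar> < 1 / (8 * D)" for K t
  proof -
    obtain w2 where w2: "K s \<bullet> w2 = 0" "norm (velocity K s - w2) \<le> B * norm (K s)"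
      "(\<forall>J\<in>\<Lambda>. J s = 0 \<longrightarrow> J = 0) \<Longrightarrow> w2 = 0" using decomp[OF K] by blast
    define \<alpha> \<beta> \<tau> where "\<alpha> = norm (K s)" and "\<beta> = norm w2" and "\<tau> = \<bar>t - s\<bar>"
    have nonneg: "\<alpha> \<ge> 0" "\<beta> \<ge> 0" "\<tau> \<ge> 0" by (simp_all add: \<alpha>_def \<beta>_def \<tau>_def)
    have \<tau>: "D * \<tau> \<le> 1 / 8" "\<tau> \<le> 1"
    proof -
      show *: "D * \<tau> \<le> 1 / 8"
        using mult_left_mono[OF less_imp_le[OF near], of D] D(1) by (simp add: \<tau>_def)
      have "1 * \<tau> \<le> D * \<tau>" using D(1) nonneg(3) by (rule mult_right_mono)
      then show "\<tau> \<le> 1" using * by linarith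
    qed
    have "norm (velocity K s) \<le> B * \<alpha> + \<beta>"
      using norm_triangle_sub[of "velocity K s" w2] w2(2) by (simp add: \<alpha>_def \<beta>_def)
    then have "norm (K s) + norm (velocity K s) \<le> (1 + B) * (\<alpha> + \<beta>)"
      using mult_nonneg_nonneg[OF less_imp_le[OF B(1)] nonneg(2)] unfolding \<alpha>_def[symmetric]
      by (simp add: algebra_simps)
    then have "C * (norm (K s) + norm (velocity K s)) \<le> C * ((1 + B) * (\<alpha> + \<beta>))"
      using C(1) by (rule mult_left_mono)
    also have "\<dots> \<le> D * (\<alpha> + \<beta>)"
      using mult_right_mono[OF D(3), of "\<alpha> + \<beta>"] nonneg by (simp add: mult.assoc)
    finally have N: "C * (norm (K s) + norm (velocity K s)) \<le> D * (\<alpha> + \<beta>)" .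
    have vel: "norm (velocity K t) \<le> D * (\<alpha> + \<beta>)"
      using C(2)[OF lagrangianD(2)[OF L K] t] N by linarith
    have rem: "norm (K t - K s - (t - s) *\<^sub>R velocity K s) \<le> D * (\<alpha> + \<beta>) * \<tau>\<^sup>2"
      using C(3)[OF lagrangianD(2)[OF L K] t] mult_right_mono[OF N, of "\<tau>\<^sup>2"] by (simp add: \<tau>_def)
    have "(norm (K s + (t - s) *\<^sub>R w2))\<^sup>2 = \<alpha>\<^sup>2 + (\<tau> * \<beta>)\<^sup>2"
      using norm_add_Pythagorean[of "K s" "(t - s) *\<^sub>R w2"] w2(1)
      by (simp add: orthogonal_def \<alpha>_def \<beta>_def \<tau>_def)
    moreover have "((\<alpha> + \<tau> * \<beta>) / 2)\<^sup>2 \<le> \<alpha>\<^sup>2 + (\<tau> * \<beta>)\<^sup>2"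
    proof -
      have "\<alpha>\<^sup>2 + (\<tau> * \<beta>)\<^sup>2 - ((\<alpha> + \<tau> * \<beta>) / 2)\<^sup>2 = (\<alpha>\<^sup>2 + (\<tau> * \<beta>)\<^sup>2) / 2 + ((\<alpha> - \<tau> * \<beta>) / 2)\<^sup>2"
        by (simp add: power2_eq_square field_simps)
      also have "\<dots> \<ge> 0" by simp
      finally show ?thesis by simp
    qed
    ultimately have "((\<alpha> + \<tau> * \<beta>) / 2)\<^sup>2 \<le> (norm (K s + (t - s) *\<^sub>R w2))\<^sup>2" by simp
    then have lower: "(\<alpha> + \<tau> * \<beta>) / 2 \<le> norm (K s + (t - s) *\<^sub>R w2)"
      by (rule power2_le_imp_le) simp
    have tang: "norm ((t - s) *\<^sub>R (velocity K s - w2)) \<le> \<tau> * (D * \<alpha>)"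
      using mult_left_mono[OF order_trans[OF w2(2) mult_right_mono[OF D(2), of "norm (K s)"]], of \<tau>] nonneg
      by (simp add: \<alpha>_def \<tau>_def)
    have "K s + (t - s) *\<^sub>R w2
        = K t - (K t - K s - (t - s) *\<^sub>R velocity K s) - (t - s) *\<^sub>R (velocity K s - w2)"
      by (simp add: algebra_simps)
    moreover have "norm x \<le> norm y + norm p + norm q" if "x = y - p - q" for x y p q :: 'a
      using norm_triangle_ineq4[of "y - p" q] norm_triangle_ineq4[of y p] that by simp
    ultimately have "norm (K s + (t - s) *\<^sub>R w2)
        \<le> norm (K t) + norm (K t - K s - (t - s) *\<^sub>R velocity K s) + norm ((t - s) *\<^sub>R (velocity K s - w2))"
      by blast
    then have "(\<alpha> + \<tau> * \<beta>) / 2 \<le> norm (K t) + D * (\<alpha> + \<beta>) * \<tau>\<^sup>2 + \<tau> * (D * \<alpha>)"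
      using lower rem tang by linarith
    moreover have "D * (\<alpha> + \<beta>) * \<tau>\<^sup>2 \<le> (\<alpha> + \<tau> * \<beta>) / 8"
    proof -
      have "D * (\<alpha> + \<beta>) * \<tau>\<^sup>2 = (D * \<tau>) * (\<tau> * \<alpha> + \<tau> * \<beta>)"
        by (simp add: power2_eq_square algebra_simps)
      also have "\<dots> \<le> (1 / 8) * (1 * \<alpha> + \<tau> * \<beta>)"
        using \<tau> nonneg D(1) by (intro mult_mono add_mono) auto
      finally show ?thesis by simp
    qed
    moreover have "\<tau> * (D * \<alpha>) \<le> (\<alpha> + \<tau> * \<beta>) / 8"
    proof -
      have "\<tau> * (D * \<alpha>) \<le> \<alpha> / 8"
        using mult_right_mono[OF \<tau>(1) nonneg(1)] by (simp add: mult_ac)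
      then show ?thesis by (rule order_trans) (use nonneg in simp)
    qed
    moreover have "x \<le> 4 * n" if "x / 2 \<le> n + p + q" "p \<le> x / 8" "q \<le> x / 8" for x n p q :: real
      using that by linarith
    ultimately have low: "\<alpha> + \<tau> * \<beta> \<le> 4 * norm (K t)" by blast
    have "\<tau> * norm (velocity K t) \<le> \<tau> * (D * (\<alpha> + \<beta>))"
      using vel nonneg by (intro mult_left_mono)
    also have "\<dots> = D * (\<tau> * \<alpha> + \<tau> * \<beta>)" by (simp add: algebra_simps)
    also have "\<dots> \<le> D * (1 * \<alpha> + \<tau> * \<beta>)"
      using \<tau>(2) nonneg D(1) by (intro mult_left_mono add_mono mult_right_mono) auto
    also have "\<dots> \<le> D * (4 * norm (K t))"
      using low D(1) by (intro mult_left_mono) auto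
    finally have "\<tau> * norm (velocity K t) \<le> 4 * D * norm (K t)" by simp
    moreover have "norm (velocity K t) \<le> 4 * D * norm (K t)" if "\<forall>J\<in>\<Lambda>. J s = 0 \<longrightarrow> J = 0"
    proof -
      have "\<beta> = 0" using w2(3)[OF that] by (simp add: \<beta>_def)
      then have "D * (\<alpha> + \<beta>) \<le> D * (4 * norm (K t))"
        using low D(1) by (intro mult_left_mono) auto
      then show ?thesis using vel by simp
    qed
    ultimately show ?thesis by (simp add: \<tau>_def)
  qed
  show thesis
    by (rule that[of "4 * D" "1 / (8 * D)"]) (use main D(1) in auto)
qed

text \<open>Writing \<open>K u\<close> for a field of \<open>\<Lambda>\<close> that agrees with \<open>Y\<close> at \<open>u\<close>, the function \<open>u \<mapsto> \<omega>(K u, Y)\<close>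
  has derivative \<open>\<bar>Y' - (K u)'\<bar>\<^sup>2\<close> off the focal points. At a focal point in \<open>{s, t}\<close> the fields \<open>K u\<close> may blow up,
  but the function stays continuous.\<close>

lemma lagrangian_comparison:
  assumes L: "lagrangian I R \<Lambda>" and Y: "Y \<in> Jac I R" and st: "s < t" and sub: "{s..t} \<subseteq> I"
    and nonfocal: "\<And>u J. s < u \<Longrightarrow> u < t \<Longrightarrow> J \<in> \<Lambda> \<Longrightarrow> J u = 0 \<Longrightarrow> J = 0"
    and Ks: "Ks \<in> \<Lambda>" "Ks s = Y s" and Kt: "Kt \<in> \<Lambda>" "Kt t = Y t"
  shows "omega I Ks Y \<le> omega I Kt Y"
    and "omega I Ks Y = omega I Kt Y \<Longrightarrow> Y \<in> \<Lambda>"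
proof -
  have uI: "u \<in> I" if "u \<in> {s..t}" for u using that sub by blast
  have "\<exists>K\<in>\<Lambda>. K u = Y u" if "s < u" "u < t" for u
  proof (rule lagrangian_evaluation_surjective[OF L])
    show u: "u \<in> I" using that uI by simp
    fix J assume "J \<in> \<Lambda>" "J u = 0"
    then have "J = 0" using nonfocal[OF that] by blast
    then show "Y u \<bullet> velocity J u = 0" using velocity_zero[OF u] by simp
  qed
  then obtain k0 where k0: "\<And>u. s < u \<Longrightarrow> u < t \<Longrightarrow> k0 u \<in> \<Lambda> \<and> k0 u u = Y u" by metis
  \<comment> \<open>Nothing ties the choices \<open>k0 u\<close> for different \<open>u\<close>
    together; regularity is proved for \<open>h\<close> only. At both ends, where evaluation may
    fail to be injective, the prescribed fields are used.\<close>
  define k where "k u = (if u = s then Ks else if u = t then Kt else k0 u)" for u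
  have k: "k u \<in> \<Lambda>" "k u u = Y u" if "u \<in> {s..t}" for u
    using k0[of u] that Ks Kt by (auto simp: k_def)
  note kJac = lagrangianD(2)[OF L k(1)]
  define h where "h u = omega I (k u) Y" for u
  define Z where "Z u0 = Y - k u0" for u0
  define \<rho> where "\<rho> u0 u = velocity (k u - k u0) u \<bullet> Z u0 u" for u0 u
  have Z: "Z u0 \<in> Jac I R" "Z u0 u0 = 0" if "u0 \<in> {s..t}" for u0
    using Y k(2)[OF that] kJac[OF that] by (auto simp: Z_def subspace_diff[OF subspace_Jac])
  \<comment> \<open>By isotropy of \<Lambda>, the increment \<open>h u - h u0\<close> is \<omega>(k
    u - k u0, Z u0). At time \<open>u\<close> both arguments have the same value, and evaluating
    \<omega> there gives the formula.\<close>
  have h_eq: "h u = h u0 + Z u0 u \<bullet> velocity (Z u0) u - \<rho> u0 u"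
    if u: "u \<in> {s..t}" "u0 \<in> {s..t}" for u u0
  proof -
    have "omega I (k u) (k u0) = 0" using lagrangianD(3)[OF L k(1) k(1)] u by blast
    then have "h u = omega I (k u) Y - omega I (k u) (k u0)" by (simp add: h_def)
    also have "\<dots> = Y u \<bullet> velocity Y u - velocity (k u) u \<bullet> Y u - (Y u \<bullet> velocity (k u0) u - velocity (k u) u \<bullet> k u0 u)"
      using omega_eq[OF kJac Y uI] omega_eq[OF kJac kJac uI] u k(2) by simp
    also have "\<dots> = (k u0 u \<bullet> velocity Y u - velocity (k u0) u \<bullet> Y u) + Z u0 u \<bullet> velocity (Z u0) u - \<rho> u0 u"
      using velocity_diff[OF Y kJac uI] velocity_diff[OF kJac kJac uI] u
      by (simp add: Z_def \<rho>_def inner_diff_left inner_diff_right inner_commute)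
    also have "k u0 u \<bullet> velocity Y u - velocity (k u0) u \<bullet> Y u = h u0"
      using omega_eq[OF kJac Y uI] u by (simp add: h_def)
    finally show ?thesis .
  qed
  have \<rho>0: "\<rho> u0 u0 = 0" if "u0 \<in> {s..t}" for u0
    using Z(2)[OF that] by (simp add: \<rho>_def)
  \<comment> \<open>\<open>Z u0\<close> vanishes at \<open>u0\<close>, so the product rule leaves
    only the square of its velocity.\<close>
  have Zderiv: "((\<lambda>u. Z u0 u \<bullet> velocity (Z u0) u) has_real_derivative (norm (velocity (Z u0) u0))\<^sup>2) (at u0 within {s..t})"
    if u0: "u0 \<in> {s..t}" for u0
  proof -
    note D = Jac_has_vector_derivative[OF Z(1)[OF u0] uI[OF u0], THEN has_vector_derivative_within_subset, OF sub]
    from has_derivative_inner[OF D[unfolded has_vector_derivative_def]] Z(2)[OF u0]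
    show ?thesis
      by (simp add: has_real_derivative_iff_has_vector_derivative has_vector_derivative_def dot_square_norm)
  qed
  \<comment> \<open>\<open>Z u0\<close> is of first order in the distance to \<open>u0\<close>. The
    velocity of \<open>k u - k u0\<close> at \<open>u\<close> is bounded in general, and of first
    order if \<open>u0\<close> is not focal. So \<open>\<rho>\<close> is of first order, enough for
    continuity, and in the second case of second order, which leaves the derivative
    unchanged.\<close>
  have bounds: "\<exists>P \<delta>. P \<ge> 0 \<and> \<delta> > 0 \<and> (\<forall>u\<in>{s..t}. \<bar>u - u0\<bar> < \<delta> \<longrightarrow> \<bar>\<rho> u0 u\<bar> \<le> P * \<bar>u - u0\<bar> \<and>
      ((\<forall>J\<in>\<Lambda>. J u0 = 0 \<longrightarrow> J = 0) \<longrightarrow> \<bar>\<rho> u0 u\<bar> \<le> P * \<bar>u - u0\<bar>\<^sup>2))"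
    if u0: "u0 \<in> {s..t}" for u0
  proof -
    obtain C \<delta> where C: "C \<ge> 0" "\<delta> > 0"
      "\<And>K u. K \<in> \<Lambda> \<Longrightarrow> u \<in> {s..t} \<Longrightarrow> \<bar>u - u0\<bar> < \<delta> \<Longrightarrow> \<bar>u - u0\<bar> * norm (velocity K u) \<le> C * norm (K u)"
      "\<And>K u. K \<in> \<Lambda> \<Longrightarrow> u \<in> {s..t} \<Longrightarrow> \<bar>u - u0\<bar> < \<delta> \<Longrightarrow> \<forall>J\<in>\<Lambda>. J u0 = 0 \<longrightarrow> J = 0 \<Longrightarrow> norm (velocity K u) \<le> C * norm (K u)"
      using lagrangian_velocity_bound[OF L sub u0] by metis
    obtain E where E: "E \<ge> 0" "\<And>J t'. J \<in> Jac I R \<Longrightarrow> t' \<in> {s..t} \<Longrightarrow>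
      norm (J t' - J u0 - (t' - u0) *\<^sub>R velocity J u0) \<le> E * (norm (J u0) + norm (velocity J u0)) * \<bar>t' - u0\<bar>\<^sup>2"
      using Jac_linearization[OF sub u0] by metis
    define v where "v = norm (velocity (Z u0) u0)"
    define Q where "Q = E * v * (t - s) + v"
    have Q: "Q \<ge> 0" using E(1) st by (simp add: Q_def v_def)
    have Zb: "norm (Z u0 u) \<le> Q * \<bar>u - u0\<bar>" if u: "u \<in> {s..t}" for u
    proof -
      have "norm (Z u0 u - (u - u0) *\<^sub>R velocity (Z u0) u0) \<le> E * v * \<bar>u - u0\<bar>\<^sup>2"
        using E(2)[OF Z(1)[OF u0] u] Z(2)[OF u0] by (simp add: v_def)
      then have "norm (Z u0 u) \<le> E * v * \<bar>u - u0\<bar>\<^sup>2 + v * \<bar>u - u0\<bar>"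
        using norm_triangle_sub[of "Z u0 u" "(u - u0) *\<^sub>R velocity (Z u0) u0"] by (simp add: v_def mult.commute)
      also have "\<dots> = E * v * \<bar>u - u0\<bar> * \<bar>u - u0\<bar> + v * \<bar>u - u0\<bar>"
        by (simp add: power2_eq_square mult.assoc)
      also have "\<dots> \<le> E * v * (t - s) * \<bar>u - u0\<bar> + v * \<bar>u - u0\<bar>"
        using u u0 E(1) by (intro add_right_mono mult_right_mono mult_left_mono) (auto simp: v_def)
      finally show ?thesis by (simp add: Q_def algebra_simps)
    qed
    have eq: "(k u - k u0) u = Z u0 u" if "u \<in> {s..t}" for u using k(2)[OF that] by (simp add: Z_def)
    have L': "k u - k u0 \<in> \<Lambda>" if "u \<in> {s..t}" for u
      using k(1) that u0 by (intro subspace_diff[OF lagrangianD(1)[OF L]])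
    have rb: "\<bar>\<rho> u0 u\<bar> \<le> norm (velocity (k u - k u0) u) * norm (Z u0 u)" for u
      unfolding \<rho>_def by (rule Cauchy_Schwarz_ineq2)
    have lin: "\<bar>\<rho> u0 u\<bar> \<le> C * Q * Q * \<bar>u - u0\<bar>" if u: "u \<in> {s..t}" and near: "\<bar>u - u0\<bar> < \<delta>" for u
    proof -
      have "\<bar>\<rho> u0 u\<bar> \<le> norm (velocity (k u - k u0) u) * (Q * \<bar>u - u0\<bar>)"
        using rb by (rule order_trans) (intro mult_left_mono Zb u norm_ge_zero)
      also have "\<dots> = Q * (\<bar>u - u0\<bar> * norm (velocity (k u - k u0) u))" by (simp add: mult_ac)
      also have "\<dots> \<le> Q * (C * norm (Z u0 u))"
        using C(3)[OF L'[OF u] u near] eq[OF u] Q by (intro mult_left_mono) auto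
      also have "\<dots> \<le> Q * (C * (Q * \<bar>u - u0\<bar>))"
        using Q C(1) Zb[OF u] by (intro mult_left_mono) auto
      finally show ?thesis by (simp add: mult_ac)
    qed
    have quad: "\<bar>\<rho> u0 u\<bar> \<le> C * Q * Q * \<bar>u - u0\<bar>\<^sup>2"
      if u: "u \<in> {s..t}" and near: "\<bar>u - u0\<bar> < \<delta>" and nf: "\<forall>J\<in>\<Lambda>. J u0 = 0 \<longrightarrow> J = 0" for u
    proof -
      have "norm (velocity (k u - k u0) u) \<le> C * norm (Z u0 u)"
        using C(4)[OF L'[OF u] u near nf] unfolding eq[OF u] .
      then have "\<bar>\<rho> u0 u\<bar> \<le> (C * norm (Z u0 u)) * norm (Z u0 u)"
        by (intro order_trans[OF rb] mult_right_mono norm_ge_zero)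
      also have "\<dots> \<le> (C * (Q * \<bar>u - u0\<bar>)) * (Q * \<bar>u - u0\<bar>)"
        using Zb[OF u] C(1) Q by (intro mult_mono) auto
      finally show ?thesis by (simp add: power2_eq_square mult_ac)
    qed
    show ?thesis
      using lin quad C(1,2) Q by (intro exI[of _ "C * Q * Q"] exI[of _ \<delta>]) auto
  qed
  have near: "\<forall>\<^sub>F u in at u0 within {s..t}. u \<in> {s..t} \<and> \<bar>u - u0\<bar> < \<delta>" if "\<delta> > 0" for u0 \<delta> :: real
    using that by (auto simp: eventually_at dist_real_def intro!: exI[of _ \<delta>])
  have cont: "continuous_on {s..t} h"
    unfolding continuous_on_def
  proof
    fix u0 assume u0: "u0 \<in> {s..t}"
    obtain P \<delta> where P: "P \<ge> 0" "\<delta> > 0" "\<forall>u\<in>{s..t}. \<bar>u - u0\<bar> < \<delta> \<longrightarrow> \<bar>\<rho> u0 u\<bar> \<le> P * \<bar>u - u0\<bar>"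
      using bounds[OF u0] by blast
    have "(\<rho> u0 \<longlongrightarrow> 0) (at u0 within {s..t})"
    proof (rule Lim_null_comparison)
      show "\<forall>\<^sub>F u in at u0 within {s..t}. norm (\<rho> u0 u) \<le> P * \<bar>u - u0\<bar>"
        using near[OF P(2)] by eventually_elim (use P(3) in auto)
      show "((\<lambda>u. P * \<bar>u - u0\<bar>) \<longlongrightarrow> 0) (at u0 within {s..t})"
        by (auto intro!: tendsto_eq_intros)
    qed
    moreover have "((\<lambda>u. Z u0 u \<bullet> velocity (Z u0) u) \<longlongrightarrow> 0) (at u0 within {s..t})"
      using DERIV_continuous[OF Zderiv[OF u0]] Z(2)[OF u0] by (simp add: continuous_within)
    ultimately have "((\<lambda>u. h u0 + Z u0 u \<bullet> velocity (Z u0) u - \<rho> u0 u) \<longlongrightarrow> h u0 + 0 - 0) (at u0 within {s..t})"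
      by (intro tendsto_intros)
    moreover have "\<forall>\<^sub>F u in at u0 within {s..t}. h u0 + Z u0 u \<bullet> velocity (Z u0) u - \<rho> u0 u = h u"
      using near[OF zero_less_one]
    proof eventually_elim
      case (elim u)
      then show ?case using h_eq[of u u0] u0 by simp
    qed
    ultimately have "(h \<longlongrightarrow> h u0 + 0 - 0) (at u0 within {s..t})"
      by (rule Lim_transform_eventually)
    then show "(h \<longlongrightarrow> h u0) (at u0 within {s..t})" by simp
  qed
  have deriv: "(h has_real_derivative (norm (velocity (Z u0) u0))\<^sup>2) (at u0)" if u0: "s < u0" "u0 < t" for u0
  proof -
    have u0': "u0 \<in> {s..t}" using u0 by auto
    have at: "at u0 within {s..t} = at u0" using u0 by (rule at_within_Icc_at)
    obtain P \<delta> where P: "P \<ge> 0" "\<delta> > 0" "\<forall>u\<in>{s..t}. \<bar>u - u0\<bar> < \<delta> \<longrightarrow> \<bar>\<rho> u0 u\<bar> \<le> P * \<bar>u - u0\<bar>\<^sup>2"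
      using bounds[OF u0'] nonfocal[OF u0] by blast
    have "(\<rho> u0 has_real_derivative 0) (at u0 within {s..t})"
      unfolding has_field_derivative_iff
    proof (rule Lim_null_comparison)
      show "\<forall>\<^sub>F u in at u0 within {s..t}. norm ((\<rho> u0 u - \<rho> u0 u0) / (u - u0)) \<le> P * \<bar>u - u0\<bar>"
        using near[OF P(2)]
      proof eventually_elim
        case (elim u)
        then have "\<bar>\<rho> u0 u\<bar> \<le> P * \<bar>u - u0\<bar> * \<bar>u - u0\<bar>" using P(3) by (simp add: power2_eq_square mult.assoc)
        then show ?case using P(1) by (cases "u = u0") (auto simp: \<rho>0[OF u0'] divide_le_eq)
      qed
      show "((\<lambda>u. P * \<bar>u - u0\<bar>) \<longlongrightarrow> 0) (at u0 within {s..t})"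
        by (auto intro!: tendsto_eq_intros)
    qed
    from DERIV_diff[OF DERIV_add[OF DERIV_const Zderiv[OF u0']] this]
    have "((\<lambda>u. h u0 + Z u0 u \<bullet> velocity (Z u0) u - \<rho> u0 u) has_real_derivative (norm (velocity (Z u0) u0))\<^sup>2) (at u0 within {s..t})"
      by simp
    then have "(h has_real_derivative (norm (velocity (Z u0) u0))\<^sup>2) (at u0 within {s..t})"
      by (rule has_field_derivative_transform_within[OF _ zero_less_one u0']) (rule h_eq[OF _ u0', symmetric])
    then show ?thesis unfolding at .
  qed
  have mono: "h x \<le> h y" if "s \<le> x" "x \<le> y" "y \<le> t" for x y
  proof (rule DERIV_nonneg_imp_increasing_open[OF that(2)])
    show "continuous_on {x..y} h" using that by (intro continuous_on_subset[OF cont]) auto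
    fix u assume "x < u" "u < y"
    then show "\<exists>d. (h has_real_derivative d) (at u) \<and> 0 \<le> d"
      using deriv[of u] that by (intro exI[of _ "(norm (velocity (Z u) u))\<^sup>2"]) auto
  qed
  have ends: "h s = omega I Ks Y" "h t = omega I Kt Y" using st by (auto simp: h_def k_def)
  show "omega I Ks Y \<le> omega I Kt Y" using mono[of s t] st ends by simp
  assume eq: "omega I Ks Y = omega I Kt Y"
  \<comment> \<open>Equal end values make the monotone \<open>h\<close> constant, so its derivative
    vanishes at the midpoint. Then \<open>Z m\<close> has zero value and velocity there, whence
    \<open>Y = k m\<close>.\<close>
  define m where "m = (s + t) / 2"
  have m: "s < m" "m < t" using st by (auto simp: m_def)
  then have m': "m \<in> {s..t}" by simp
  have const: "h u = h s" if "s \<le> u" "u \<le> t" for u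
    using mono[of s u] mono[of u t] eq ends that by auto
  have "(h has_real_derivative 0) (at m within {s<..<t})"
  proof (rule has_field_derivative_transform_within[OF DERIV_const zero_less_one])
    show "h s = h u" if "u \<in> {s<..<t}" for u using const[of u] that by simp
  qed (use m in simp)
  then have "(h has_real_derivative 0) (at m)"
    using m at_within_open[of m "{s<..<t}"] by simp
  then have "(norm (velocity (Z m) m))\<^sup>2 = 0"
    using DERIV_unique deriv[OF m] by blast
  then have "Z m = 0"
    using Z[OF m'] by (intro Jac_eqI[OF Z(1)[OF m'] _ uI[OF m']])
      (auto simp: subspace_0[OF subspace_Jac] velocity_zero[OF uI[OF m']])
  then have "Y = k m" by (simp add: Z_def)
  then show "Y \<in> \<Lambda>" using k(1)[OF m'] by simp
qed

section \<open>Counting focal points\<close>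

text \<open>More than 2 dim V fields have a nontrivial combination with zero value and velocity at
  one time, and such a Jacobi field is zero.\<close>

lemma finite_independent_Jac:
  assumes B: "B \<subseteq> Jac I R" "independent B"
  shows "finite B"
proof (rule ccontr)
  assume "infinite B"
  then obtain F where F: "F \<subseteq> B" "finite F" "card F = Suc (card (Basis :: ('a \<times> 'a) set))"
    using infinite_arbitrarily_large by blast
  obtain t where t: "t \<in> I" using nondegenerate interior_subset by blast
  have "\<exists>c. (\<exists>J\<in>F. c J \<noteq> 0) \<and> (\<forall>b\<in>Basis. (\<Sum>J\<in>F. c J * ((J t, velocity J t) \<bullet> b)) = 0)"
    by (rule homogeneous_system_nontrivial_solution) (use F in auto)
  then obtain c where c: "\<exists>J\<in>F. c J \<noteq> 0"
    "\<And>b. b \<in> Basis \<Longrightarrow> (\<Sum>J\<in>F. c J * ((J t, velocity J t) \<bullet> b)) = 0" by blast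
  define K where "K = (\<Sum>J\<in>F. c J *\<^sub>R J)"
  have FJ: "J \<in> Jac I R" if "J \<in> F" for J using that F(1) B(1) by blast
  have K: "K \<in> Jac I R"
    unfolding K_def using FJ by (intro subspace_sum subspace_scale subspace_Jac)
  have "(\<Sum>J\<in>F. c J *\<^sub>R (J t, velocity J t)) = 0"
    by (rule euclidean_eqI) (simp add: inner_sum_left c(2) del: scaleR_Pair)
  moreover have "(\<Sum>J\<in>F. c J *\<^sub>R (J t, velocity J t)) = (K t, velocity K t)"
    unfolding K_def
    by (simp add: sum_fun_apply velocity_sum velocity_scaleR FJ t subspace_scale[OF subspace_Jac] sum_prod)
  ultimately have "K = 0"
    by (intro Jac_eqI[OF K subspace_0[OF subspace_Jac] t]) (simp_all add: velocity_zero[OF t] zero_prod_def)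
  then show False
    using independentD[OF B(2) F(2,1)] c(1) unfolding K_def by blast
qed

lemma subspace_focal:
  "lagrangian I R \<Lambda> \<Longrightarrow> subspace {J \<in> \<Lambda>. J t = 0}"
  using lagrangianD(1)[of \<Lambda>] unfolding subspace_def by simp

text \<open>\<open>dim\<close> is also 0 when a basis is infinite; finiteness of independent sets of
  Jacobi fields excludes this case.\<close>

lemma focal_index_eq_0D:
  assumes L: "lagrangian I R \<Lambda>" and f: "focal_index \<Lambda> t = 0" and J: "J \<in> \<Lambda>" "J t = 0"
  shows "J = 0"
proof -
  obtain B where B: "B \<subseteq> {J \<in> \<Lambda>. J t = 0}" "independent B" "{J \<in> \<Lambda>. J t = 0} \<subseteq> span B"
    "card B = dim {J \<in> \<Lambda>. J t = 0}"
    using basis_exists by blast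
  have "finite B" using B(1,2) lagrangianD(2)[OF L] by (intro finite_independent_Jac) auto
  then have "B = {}" using B(4) f by (simp add: focal_index_def)
  then show ?thesis using B(3) J by auto
qed

text \<open>Points of \<open>T\<close> may be non-focal, which allows any finite set of times to be
  completed by the \<Lambda>2-focal ones.\<close>

lemma sum_focal_index_le:
  assumes L1: "lagrangian I R \<Lambda>1" and L2: "lagrangian I R \<Lambda>2"
    and T: "finite T" "T \<subseteq> I" "T \<noteq> {}"
    and nonfocal: "\<And>s t u J. s \<in> T \<Longrightarrow> t \<in> T \<Longrightarrow> s < u \<Longrightarrow> u < t \<Longrightarrow> u \<notin> T \<Longrightarrow> J \<in> \<Lambda>2 \<Longrightarrow> J u = 0 \<Longrightarrow> J = 0"
  shows "(\<Sum>t\<in>T. focal_index \<Lambda>1 t) \<le> (\<Sum>t\<in>T. focal_index \<Lambda>2 t) + DIM('a)"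
proof (rule ccontr)
  assume contra: "\<not> ?thesis"
  define W where "W \<Lambda> t = {J \<in> \<Lambda>. J t = 0}" for \<Lambda> :: "(real \<Rightarrow> 'a) set" and t
  have W: "subspace (W \<Lambda>1 t)" "subspace (W \<Lambda>2 t)"
    "W \<Lambda>1 t \<subseteq> Jac I R" "W \<Lambda>2 t \<subseteq> Jac I R" for t
    using subspace_focal[OF L1] subspace_focal[OF L2] lagrangianD(2)[OF L1] lagrangianD(2)[OF L2]
    by (auto simp: W_def)
  \<comment> \<open>Among the fields vanishing at \<open>t\<close>, \<open>C t\<close> supplies
    directions of \<Lambda>1 transversal to \<Lambda>2, while \<open>G t\<close> together with the
    common fields spans those of \<Lambda>2. Their cardinalities differ as the focal indices
    do.\<close>
  define complements where "complements t C G \<longleftrightarrow> finite C \<and> finite G \<and> C \<subseteq> W \<Lambda>1 t \<and> G \<subseteq> W \<Lambda>2 t \<and>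
      dim (W \<Lambda>1 t) + card G = dim (W \<Lambda>2 t) + card C \<and>
      (\<forall>c. (\<Sum>x\<in>C. c x *\<^sub>R x) \<in> W \<Lambda>2 t \<longrightarrow> (\<forall>x\<in>C. c x = 0)) \<and>
      W \<Lambda>2 t \<subseteq> span (G \<union> (W \<Lambda>1 t \<inter> W \<Lambda>2 t))" for t C G
  have "\<exists>C G. complements t C G" for t
    unfolding complements_def using W(3,4)[of t]
    by (intro relative_complement_bases[OF W(1,2)] finite_independent_Jac) (blast+)
  then obtain C G where CG: "\<And>t. complements t (C t) (G t)" by metis
  then have CG: "\<And>t. finite (C t)" "\<And>t. finite (G t)" "\<And>t. C t \<subseteq> W \<Lambda>1 t" "\<And>t. G t \<subseteq> W \<Lambda>2 t"
    "\<And>t. dim (W \<Lambda>1 t) + card (G t) = dim (W \<Lambda>2 t) + card (C t)"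
    "\<And>t c. (\<Sum>x\<in>C t. c x *\<^sub>R x) \<in> W \<Lambda>2 t \<Longrightarrow> \<forall>x\<in>C t. c x = 0"
    "\<And>t. W \<Lambda>2 t \<subseteq> span (G t \<union> (W \<Lambda>1 t \<inter> W \<Lambda>2 t))"
    unfolding complements_def by blast+
  define a b where "a = Min T" and "b = Max T"
  have ab: "a \<in> T" "b \<in> T" "\<And>t. t \<in> T \<Longrightarrow> a \<le> t" "\<And>t. t \<in> T \<Longrightarrow> t \<le> b"
    using T by (auto simp: a_def b_def)
  have TI: "t \<in> I" if "t \<in> T" for t using that T(2) by blast

  \<comment> \<open>The unknowns of the linear system are the coefficients of the fields \<open>F t\<close> below. The last \<open>DIM('a)\<close>
      equations read \<open>Y a a + velocity (F a) a = 0\<close>; its two summands are orthogonal, so both vanish.\<close>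
  define A where "A = Sigma T C"
  define Q :: "(real \<times> (real \<Rightarrow> 'a) + 'a) set" where "Q = Sigma T G <+> Basis"
  define M where "M p q = (case q of
      Inl (s, K) \<Rightarrow> (if s < fst p then snd p s \<bullet> velocity K s else 0)
    | Inr u \<Rightarrow> (snd p a + (if fst p = a then velocity (snd p) a else 0)) \<bullet> u)" for p and q :: "real \<times> (real \<Rightarrow> 'a) + 'a"
  have "(\<Sum>t\<in>T. focal_index \<Lambda>1 t) + (\<Sum>t\<in>T. card (G t)) = (\<Sum>t\<in>T. focal_index \<Lambda>2 t) + (\<Sum>t\<in>T. card (C t))"
    using CG(5) by (simp add: focal_index_def W_def flip: sum.distrib)
  then have "(\<Sum>t\<in>T. card (G t)) + DIM('a) < (\<Sum>t\<in>T. card (C t))" using contra by linarith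
  then have "card Q < card A"
    using T(1) CG(1,2) by (simp add: A_def Q_def card_Plus)
  moreover have "finite A" "finite Q" using T(1) CG(1,2) by (auto simp: A_def Q_def)
  ultimately obtain c where c: "\<exists>p\<in>A. c p \<noteq> 0" "\<And>q. q \<in> Q \<Longrightarrow> (\<Sum>p\<in>A. c p * M p q) = 0"
    using homogeneous_system_nontrivial_solution[of Q A M] by blast
  define F where "F t = (\<Sum>J\<in>C t. c (t, J) *\<^sub>R J)" for t
  define Y where "Y s = (\<Sum>t\<in>{t \<in> T. s < t}. F t)" for s
  have FW: "F t \<in> W \<Lambda>1 t" for t
    unfolding F_def using CG(3) by (intro subspace_sum subspace_scale W) auto
  have F: "F t \<in> \<Lambda>1" "F t t = 0" "F t \<in> Jac I R" for t
    using FW[of t] W by (auto simp: W_def)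
  have Y: "Y s \<in> \<Lambda>1" "Y s \<in> Jac I R" for s
    unfolding Y_def using F by (auto intro!: subspace_sum lagrangianD(1)[OF L1] subspace_Jac)
  have CJ: "J \<in> Jac I R" if "J \<in> C t" for J t using that CG(3) W(3) by blast
  have F_apply: "F t s = (\<Sum>J\<in>C t. c (t, J) *\<^sub>R J s)" for t s
    by (simp add: F_def sum_fun_apply)
  have F_velocity: "velocity (F t) s = (\<Sum>J\<in>C t. c (t, J) *\<^sub>R velocity J s)" if "s \<in> I" for t s
    unfolding F_def using that CJ
    by (subst velocity_sum) (auto simp: velocity_scaleR intro!: subspace_scale subspace_Jac)
  have Y_apply: "Y s u = (\<Sum>t\<in>T. if s < t then F t u else 0)" for s u
    unfolding Y_def sum_fun_apply using T(1) by (rule sum.inter_filter)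
  have Y_last: "Y b = 0"
    using ab(4) by (auto simp: Y_def intro!: sum.neutral) (meson leD)
  have sumA: "(\<Sum>p\<in>A. c p * M p q) = (\<Sum>t\<in>T. \<Sum>J\<in>C t. c (t, J) * M (t, J) q)" for q
    unfolding A_def using T(1) CG(1) by (subst sum.Sigma) (auto simp: case_prod_unfold)

  have G_orth: "Y s s \<bullet> velocity K s = 0" if "s \<in> T" "K \<in> G s" for s K
  proof -
    have "0 = (\<Sum>p\<in>A. c p * M p (Inl (s, K)))"
      using c(2)[of "Inl (s, K)"] that by (simp add: Q_def InlI)
    also have "\<dots> = (\<Sum>t\<in>T. (if s < t then F t s else 0) \<bullet> velocity K s)"
      unfolding sumA by (intro sum.cong refl) (auto simp: M_def F_apply inner_sum_left)
    also have "\<dots> = Y s s \<bullet> velocity K s" by (simp add: Y_apply inner_sum_left)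
    finally show ?thesis by simp
  qed
  have "Y a a + velocity (F a) a = 0"
  proof (rule euclidean_eqI)
    fix u :: 'a assume u: "u \<in> Basis"
    have "0 = (\<Sum>p\<in>A. c p * M p (Inr u))"
      using c(2)[of "Inr u"] u by (simp add: Q_def InrI)
    also have "\<dots> = (\<Sum>t\<in>T. (F t a + (if t = a then velocity (F t) a else 0)) \<bullet> u)"
      unfolding sumA using TI[OF ab(1)]
      by (intro sum.cong refl)
         (auto simp: M_def F_apply F_velocity inner_sum_left inner_add_left distrib_left sum.distrib)
    \<comment> \<open>At \<open>t = a\<close> the value \<open>F a a\<close> is zero, so the strict
      inequality in \<open>Y a\<close> loses nothing.\<close>
    also have "\<dots> = (\<Sum>t\<in>T. ((if a < t then F t a else 0) + (if t = a then velocity (F a) a else 0)) \<bullet> u)"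
      using ab(3) F(2) by (intro sum.cong refl) (auto simp: order.order_iff_strict)
    also have "\<dots> = (Y a a + velocity (F a) a) \<bullet> u"
      using T(1) ab(1) by (simp add: Y_apply sum.distrib flip: inner_sum_left)
    finally show "(Y a a + velocity (F a) a) \<bullet> u = 0 \<bullet> u" by simp
  qed
  moreover have "Y a a \<bullet> velocity (F a) a = 0"
    by (rule lagrangian_velocity_orthogonal[OF L1 F(1) Y(1) TI[OF ab(1)] F(2)])
  ultimately have Ya: "Y a a = 0" and va: "velocity (F a) a = 0"
    by (auto simp: add_eq_0_iff)
  \<comment> \<open>\<open>F a\<close> enters no \<open>Y s\<close> with \<open>s\<close> in
    \<open>T\<close>, so it cannot be recovered later as a difference and must be seen to vanish
    here.\<close>
  have Fa: "F a = 0"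
    using Jac_eqI[OF F(3) subspace_0[OF subspace_Jac] TI[OF ab(1)], of a] F(2)[of a] va
    by (simp add: velocity_zero[OF TI[OF ab(1)]])

  have "\<exists>K\<in>\<Lambda>2. K s = Y s s" if s: "s \<in> T" for s
  proof (rule lagrangian_evaluation_surjective[OF L2 TI[OF s]])
    fix K assume K: "K \<in> \<Lambda>2" "K s = 0"
    \<comment> \<open>Orthogonality is linear in \<open>K\<close>, so generators suffice:
      \<open>G s\<close> by the linear system, common fields by isotropy of \<Lambda>1, which
      contains \<open>Y s\<close>.\<close>
    have "subspace {K \<in> Jac I R. Y s s \<bullet> velocity K s = 0}"
      using subspace_Jac[of I R] TI[OF s]
      by (auto simp: subspace_def velocity_zero velocity_add velocity_scaleR inner_add_right)
    moreover have "G s \<union> (W \<Lambda>1 s \<inter> W \<Lambda>2 s) \<subseteq> {K \<in> Jac I R. Y s s \<bullet> velocity K s = 0}"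
    proof
      fix K assume "K \<in> G s \<union> (W \<Lambda>1 s \<inter> W \<Lambda>2 s)"
      then show "K \<in> {K \<in> Jac I R. Y s s \<bullet> velocity K s = 0}"
      proof
        assume "K \<in> G s"
        then show ?thesis using G_orth[OF s] CG(4) W(4) by blast
      next
        assume "K \<in> W \<Lambda>1 s \<inter> W \<Lambda>2 s"
        then show ?thesis
          using lagrangian_velocity_orthogonal[OF L1 _ Y(1) TI[OF s], of K s] lagrangianD(2)[OF L1]
          by (auto simp: W_def)
      qed
    qed
    ultimately have "span (G s \<union> (W \<Lambda>1 s \<inter> W \<Lambda>2 s)) \<subseteq> {K \<in> Jac I R. Y s s \<bullet> velocity K s = 0}"
      by (intro span_minimal)
    then show "Y s s \<bullet> velocity K s = 0" using CG(7)[of s] K by (auto simp: W_def)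
  qed
  then obtain k where k: "\<And>s. s \<in> T \<Longrightarrow> k s \<in> \<Lambda>2" "\<And>s. s \<in> T \<Longrightarrow> k s s = Y s s" by metis
  note kJ = lagrangianD(2)[OF L2 k(1)]
  define \<eta> where "\<eta> s = omega I (k s) (Y s)" for s

  have step: "Y s = F t + Y t" "\<eta> s \<le> \<eta> t" "\<eta> s = \<eta> t \<Longrightarrow> Y s \<in> \<Lambda>2"
    if st: "s \<in> T" "t \<in> T" "s < t" and consecutive: "\<And>u. u \<in> T \<Longrightarrow> \<not> (s < u \<and> u < t)" for s t
  proof -
    have "{u \<in> T. s < u} = insert t {u \<in> T. t < u}"
      using st consecutive by (auto intro: less_trans) (meson linorder_neqE)
    then show Yst: "Y s = F t + Y t" using T(1) by (simp add: Y_def)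
    \<comment> \<open>\<open>Y s\<close> and \<open>Y t\<close> differ by \<open>F t\<close>, which does not change \<open>\<eta>\<close> at the break point \<open>t\<close>.\<close>
    have "k t t \<bullet> velocity (F t) t = 0"
      unfolding k(2)[OF st(2)] by (rule lagrangian_velocity_orthogonal[OF L1 F(1) Y(1) TI[OF st(2)] F(2)])
    then have \<eta>t: "\<eta> t = omega I (k t) (Y s)"
      unfolding \<eta>_def Yst using F(2)[of t] TI[OF st(2)]
      by (simp add: omega_eq[OF kJ[OF st(2)] _ TI[OF st(2)]] Y F subspace_add[OF subspace_Jac]
          velocity_add inner_add_right)
    have sub: "{s..t} \<subseteq> I"
      using mem_is_interval_1_I[OF interval TI[OF st(1)] TI[OF st(2)]] by auto
    have Yt: "k t t = Y s t" using k(2)[OF st(2)] by (simp add: Yst F(2))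
    have nf: "J = 0" if "s < u" "u < t" "J \<in> \<Lambda>2" "J u = 0" for u J
      using nonfocal[OF st(1,2) that(1,2) _ that(3,4)] consecutive[of u] that(1,2) by blast
    note comparison = lagrangian_comparison[OF L2 Y(2) st(3) sub nf k(1)[OF st(1)] k(2)[OF st(1)] k(1)[OF st(2)] Yt]
    show "\<eta> s \<le> \<eta> t" unfolding \<eta>t unfolding \<eta>_def by (rule comparison(1))
    show "Y s \<in> \<Lambda>2" if "\<eta> s = \<eta> t"
      using that unfolding \<eta>t unfolding \<eta>_def by (intro comparison(2))
  qed
  \<comment> \<open>At \<open>a\<close> both \<open>k a\<close> and \<open>Y a\<close> have value
    zero, and \<open>Y b\<close> is the zero field; monotonicity then makes \<open>\<eta>\<close>
    vanish on all of \<open>T\<close>.\<close>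
  have "\<eta> a = 0" "\<eta> b = 0"
    using omega_eq[OF kJ[OF ab(1)] Y(2) TI[OF ab(1)], of a] k(2)[OF ab(1)] Ya
      omega_eq[OF kJ[OF ab(2)] Y(2) TI[OF ab(2)], of b] velocity_zero[OF TI[OF ab(2)]]
    by (simp_all add: \<eta>_def Y_last)
  moreover have "\<eta> s \<le> \<eta> t" if "s \<in> T" "t \<in> T" "s \<le> t" for s t
    by (rule monotone_on_finite_set[OF T(1) step(2) that])
  ultimately have \<eta>0: "\<eta> s = 0" if "s \<in> T" for s
    using that ab by (metis order_antisym)
  have Y2: "Y s \<in> \<Lambda>2" if s: "s \<in> T" for s
  proof (cases "s = b")
    case True
    then show ?thesis using subspace_0[OF lagrangianD(1)[OF L2]] by (simp add: Y_last)
  next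
    case False
    define t where "t = Min {u \<in> T. s < u}"
    have ne: "{u \<in> T. s < u} \<noteq> {}" using ab(2,4) s False by force
    have "t \<in> {u \<in> T. s < u}" unfolding t_def using T(1) ne by (intro Min_in) auto
    moreover have "\<not> (s < u \<and> u < t)" if "u \<in> T" for u
    proof
      assume "s < u \<and> u < t"
      then show False using that T(1) Min_le[of "{u \<in> T. s < u}" u] by (simp add: t_def[symmetric])
    qed
    ultimately show ?thesis using step(3)[of s t] s \<eta>0 by auto
  qed
  have F2: "F t \<in> \<Lambda>2" if t: "t \<in> T" for t
  proof (cases "t = a")
    case True
    then show ?thesis using subspace_0[OF lagrangianD(1)[OF L2]] by (simp add: Fa)
  next
    case False
    \<comment> \<open>With \<open>s\<close> the predecessor of \<open>t\<close> in \<open>T\<close>,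
      the jump at \<open>t\<close> exhibits \<open>F t\<close> as a difference of fields in
      \<Lambda>2.\<close>
    define s where "s = Max {u \<in> T. u < t}"
    have ne: "{u \<in> T. u < t} \<noteq> {}" using ab(1,3) t False by force
    have s: "s \<in> {u \<in> T. u < t}" unfolding s_def using T(1) ne by (intro Max_in) auto
    moreover have "\<not> (s < u \<and> u < t)" if "u \<in> T" for u
    proof
      assume "s < u \<and> u < t"
      then show False using that T(1) Max_ge[of "{u \<in> T. u < t}" u] by (simp add: s_def[symmetric])
    qed
    ultimately have "Y s = F t + Y t" using t by (intro step(1)) auto
    then have "F t = Y s - Y t" by simp
    then show ?thesis using Y2 s t by (auto intro: subspace_diff lagrangianD(1)[OF L2])
  qed
  have "c (t, J) = 0" if "t \<in> T" "J \<in> C t" for t J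
  proof -
    have "F t \<in> W \<Lambda>2 t" using F2[OF that(1)] F(2) by (simp add: W_def)
    then show ?thesis using CG(6)[of "\<lambda>J. c (t, J)" t] that(2) unfolding F_def by blast
  qed
  then show False using c(1) by (auto simp: A_def)
qed

end

section \<open>From finite sets of times to the index\<close>

lemma smooth_family_on_imp_continuous_on:
  assumes "smooth_family_on S f"
  shows "continuous_on S f"
proof -
  obtain D where D: "\<forall>t\<in>S. D 0 t = f t"
    "\<forall>n. \<forall>t\<in>S. (D n has_vector_derivative D (Suc n) t) (at t within S)"
    using assms unfolding smooth_family_on_def by blast
  have "continuous_on S (D 0)"
    using D(2) by (intro continuous_on_vector_derivative) blast
  then show ?thesis using D(1) by (simp cong: continuous_on_cong)
qed

lemma ind_eq_SUP: "ind W I0 = (SUP F\<in>{F. finite F \<and> F \<subseteq> I0}. enat (\<Sum>t\<in>F. focal_index W t))"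
proof -
  have "(\<Sum>t\<in>F. enat (focal_index W t)) = enat (\<Sum>t\<in>F. focal_index W t)" for F
    by (simp flip: of_nat_eq_enat)
  then show ?thesis
    unfolding ind_def by (subst nonneg_infsum_complete) simp_all
qed

theorem theorem1p1:
  fixes I I0 :: "real set"
    and R :: "real \<Rightarrow> 'a::euclidean_space \<Rightarrow>\<^sub>L 'a"
    and \<Lambda>1 \<Lambda>2 :: "(real \<Rightarrow> 'a) set"
  assumes "is_interval I" and "interior I \<noteq> {}"
    and "smooth_family_on I R"
    and "\<And>t. t \<in> I \<Longrightarrow> symmetric_endo (R t)"
    and "lagrangian I R \<Lambda>1" and "lagrangian I R \<Lambda>2"
    and "is_interval I0" and "I0 \<subseteq> I"
  shows "ind \<Lambda>1 I0 \<le> ind \<Lambda>2 I0 + enat DIM('a)"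
proof -
  interpret jacobi_equation I R
    by standard (use assms smooth_family_on_imp_continuous_on in auto)
  show ?thesis
  proof (cases "ind \<Lambda>2 I0")
    case (enat m)
    have bound: "(\<Sum>t\<in>F. focal_index \<Lambda>2 t) \<le> m" if "finite F" "F \<subseteq> I0" for F
    proof -
      have "enat (\<Sum>t\<in>F. focal_index \<Lambda>2 t) \<le> ind \<Lambda>2 I0"
        unfolding ind_eq_SUP using that by (intro SUP_upper) auto
      then show ?thesis by (simp add: enat)
    qed
    define S where "S = {t \<in> I0. focal_index \<Lambda>2 t \<noteq> 0}"
    \<comment> \<open>Otherwise m + 1 focal times would each contribute at least 1 to a partial sum
      bounded by m.\<close>
    have finS: "finite S"
    proof (rule ccontr)
      assume "infinite S"
      then obtain F where F: "F \<subseteq> S" "finite F" "card F = Suc m"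
        using infinite_arbitrarily_large by blast
      have "card F \<le> (\<Sum>t\<in>F. focal_index \<Lambda>2 t)"
        using F(1) sum_mono[of F "\<lambda>_. 1" "focal_index \<Lambda>2"] by (force simp: S_def)
      then show False using bound[OF F(2)] F by (auto simp: S_def)
    qed
    \<comment> \<open>Adding \<open>S\<close> only enlarges the \<Lambda>1-sum and puts every
      \<Lambda>2-focal time of \<open>I0\<close> into the set; times between its points stay in the
      interval \<open>I0\<close>. The empty set is treated apart because the finite inequality needs
      a least and a greatest time.\<close>
    have "(\<Sum>t\<in>F. focal_index \<Lambda>1 t) \<le> m + DIM('a)" if F: "finite F" "F \<subseteq> I0" for F
    proof (cases "F \<union> S = {}")
      case False
      have FS: "finite (F \<union> S)" "F \<union> S \<subseteq> I0" using F finS by (auto simp: S_def)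
      have "(\<Sum>t\<in>F. focal_index \<Lambda>1 t) \<le> (\<Sum>t\<in>F \<union> S. focal_index \<Lambda>1 t)"
        using FS(1) by (intro sum_mono2) auto
      also have "\<dots> \<le> (\<Sum>t\<in>F \<union> S. focal_index \<Lambda>2 t) + DIM('a)"
      proof (rule sum_focal_index_le[OF assms(5,6) FS(1) _ False])
        show "F \<union> S \<subseteq> I" using FS(2) assms(8) by blast
        fix s t u J
        assume *: "s \<in> F \<union> S" "t \<in> F \<union> S" "s < u" "u < t" "u \<notin> F \<union> S" "J \<in> \<Lambda>2" "J u = 0"
        have "u \<in> I0"
          using mem_is_interval_1_I[OF assms(7), of s t u] * FS(2) by auto
        then have "focal_index \<Lambda>2 u = 0" using *(5) by (auto simp: S_def)
        then show "J = 0" using *(6,7) by (rule focal_index_eq_0D[OF assms(6)])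
      qed
      also have "\<dots> \<le> m + DIM('a)" using bound[OF FS] by simp
      finally show ?thesis .
    qed simp
    then show ?thesis
      unfolding enat ind_eq_SUP[of \<Lambda>1] by (intro SUP_least) simp
  qed simp
qed

end
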